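(* Let $x(n)=A_1e^{j2\pi f_1n}+A_2e^{j2\pi f_2n}+w(n)$, $n=0,\ldots,N-1$ (the case $L=2$), and suppose that $|f_1-f_2|\sim O(1)$, i.e. the frequency separation is independent of $N$. Let $\nu_1,\nu_2$ be the current estimates of the residuals $\delta_1,\delta_2$, and let $\hat f_1$ be the frequency estimate of the first component produced from them by the leakage-subtraction interpolation step described in the context. Then $\hat f_1$ asymptotically converges to a normal: $$\hat f_1\to\mathcal N\left(f_1+\mu_{f_1},\ \sigma^2_{f_1}\right),$$ where $$\mu_{f_1}=\frac{\pi[(\delta_1-\nu_1)^2-0.25]}{2A_1\cos(\pi(\delta_1-\nu_1))}\Big\{[1-2(\delta_1-\nu_1)]\,\mathrm{Im}\{e^{-j2\pi(\delta_1-\nu_1)}\beta_+\}+[1+2(\delta_1-\nu_1)]\,\mathrm{Im}\{e^{-j2\pi(\delta_1-\nu_1)}\beta_-\}\Big\}$$ and $$\sigma^2_{f_1}=\frac{\pi^2[(\delta_1-\nu_1)^2-0.25]^2}{4\rho_1N^3\cos^2(\pi(\delta_1-\nu_1))}\,[1+4(\delta_1-\nu_1)^2].$$ Furthermore, $\mu_{f_1}\big|_{\delta_1=\nu_1,\ \delta_2=\nu_2}=0$, meaning that the estimator is unbiased at the true frequencies.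
   Context: Signal model: $A_1,A_2\in\mathbb{C}\setminus\{0\}$, $f_l\in[-0.5,0.5]$, and $w(n)$ is additive (white, circular complex) Gaussian noise with zero mean and variance $\sigma^2$; $\rho_1=|A_1|^2/\sigma^2$. One writes $f_l=(\hat m_l+\delta_l)/N$, where the integer $\hat m_l$ is the (correct) maximum bin of component $l$ in the $N$-point periodogram and $\delta_l\in[-0.5,0.5]$. Put $M=\hat m_2-\hat m_1$. The notation $\hat f\to\mathcal N(f+\mu,\sigma_f^2)$, where $\mu,\sigma_f^2$ may depend on $N$, means that $(\hat f-f-\mu)/\sigma_f$ converges in distribution to the standard normal as $N\to\infty$. Estimation step. Given $\nu_1,\nu_2$ and a current amplitude estimate $\hat A_1$, let $$\hat A_2=\frac1N\sum_{n=0}^{N-1}\left[x(n)-\hat A_1e^{j\frac{2\pi}{N}(\hat m_1+\nu_1)n}\right]e^{-j\frac{2\pi}{N}(\hat m_2+\nu_2)n},$$ $$\hat S_\pm=\frac1N\sum_{n=0}^{N-1}x(n)e^{-j\frac{2\pi}{N}(\hat m_1+\nu_1\pm0.5)n}-\frac{\hat A_2}{N}\,\frac{1+e^{j2\pi(\nu_2-\nu_1)}}{1-e^{j\frac{2\pi}{N}(M+\nu_2-\nu_1\mp0.5)}},$$ $$\hat h_1=\frac12\,\frac{\hat S_++\hat S_-}{\hat S_+-\hat S_-},\qquad \hat z_1^{-1}=\cos(\pi/N)-2j\hat h_1\sin(\pi/N),$$ $$\hat\delta_1=\nu_1-\frac{N}{2\pi}\,\mathrm{Im}\{\ln\hat z_1^{-1}\},\qquad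 \hat f_1=\frac{\hat m_1+\hat\delta_1}{N}.$$ The quantities $\beta_\pm$ are $$\beta_\pm=\frac{1+e^{j2\pi(\delta_2-\nu_1)}}{1-e^{j\frac{2\pi}{N}(M+\delta_2-\nu_1\mp0.5)}}-\frac{\left(1-e^{j2\pi(\delta_2-\nu_2)}\right)\left(1+e^{j2\pi(\nu_2-\nu_1)}\right)}{N\left(1-e^{j\frac{2\pi}{N}(\delta_2-\nu_2)}\right)\left(1-e^{j\frac{2\pi}{N}(M+\nu_2-\nu_1\mp0.5)}\right)},$$ with the factor $\frac{1-e^{j2\pi(\delta_2-\nu_2)}}{N(1-e^{j2\pi(\delta_2-\nu_2)/N})}$ read as its limit $1$ when $\delta_2=\nu_2$.
   Formalization: The bias has an added factor 1/N^2 (as printed it need not vanish and the limit fails) and 1/A_1 is put inside Im; ν_1, ν_2 are deterministic in [-1/2,1/2], Â_1 is bounded in probability, |f_1-f_2|≠1, and 0/0 at |δ_1-ν_1|=1/2 is read as its limit. *)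

theory Defs
  imports "HOL-Probability.Probability"
begin

text \<open>
  Conventions: \<open>m1, m2\<close> are the periodogram bins of the two components, \<open>\<nu>1, \<nu>2\<close> the current
  residual estimates, \<open>\<delta>1, \<delta>2\<close> the true residuals. The parameter \<open>s\<close> is \<open>1/2\<close> for the
  quantities with index \<open>+\<close> and \<open>-1/2\<close> for those with index \<open>-\<close>.
\<close>

text \<open>White circular complex Gaussian noise of variance \<open>\<sigma>\<^sup>2\<close>: all the real and imaginary parts
  (the index \<open>(n, True)\<close> stands for the real part, \<open>(n, False)\<close> for the imaginary part)
  are independent, each normal with mean \<open>0\<close> and variance \<open>\<sigma>\<^sup>2 / 2\<close>.\<close>

definition white_circular_gaussian :: "'a measure \<Rightarrow> real \<Rightarrow> (nat \<Rightarrow> 'a \<Rightarrow> complex) \<Rightarrow> bool" where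
  "white_circular_gaussian P \<sigma> w \<longleftrightarrow>
     prob_space.indep_vars P (\<lambda>_. borel)
       (\<lambda>(n, re) \<omega>. if re then Re (w n \<omega>) else Im (w n \<omega>)) (UNIV :: (nat \<times> bool) set) \<and>
     (\<forall>n. distributed P lborel (\<lambda>\<omega>. Re (w n \<omega>)) (normal_density 0 (\<sigma> / sqrt 2))) \<and>
     (\<forall>n. distributed P lborel (\<lambda>\<omega>. Im (w n \<omega>)) (normal_density 0 (\<sigma> / sqrt 2)))"

definition bounded_in_probability :: "'a measure \<Rightarrow> (nat \<Rightarrow> 'a \<Rightarrow> complex) \<Rightarrow> bool" where
  "bounded_in_probability P X \<longleftrightarrow>
     (\<forall>\<epsilon>>0. \<exists>K. \<forall>\<^sub>F N in sequentially. measure P {\<omega> \<in> space P. norm (X N \<omega>) > K} \<le> \<epsilon>)"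

definition two_tone :: "complex \<Rightarrow> complex \<Rightarrow> real \<Rightarrow> real \<Rightarrow> (nat \<Rightarrow> 'a \<Rightarrow> complex)
    \<Rightarrow> 'a \<Rightarrow> nat \<Rightarrow> complex" where
  "two_tone A1 A2 f1 f2 w \<omega> n = A1 * cis (2 * pi * f1 * n) + A2 * cis (2 * pi * f2 * n) + w n \<omega>"

definition A2_hat :: "nat \<Rightarrow> (nat \<Rightarrow> complex) \<Rightarrow> complex \<Rightarrow> int \<Rightarrow> int \<Rightarrow> real \<Rightarrow> real \<Rightarrow> complex" where
  "A2_hat N x a1 m1 m2 \<nu>1 \<nu>2 =
     1 / of_nat N * (\<Sum>n<N. (x n - a1 * cis (2 * pi / N * (m1 + \<nu>1) * n))
                              * cis (- (2 * pi / N * (m2 + \<nu>2) * n)))"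

definition S_hat :: "nat \<Rightarrow> (nat \<Rightarrow> complex) \<Rightarrow> complex \<Rightarrow> int \<Rightarrow> int \<Rightarrow> real \<Rightarrow> real \<Rightarrow> real \<Rightarrow> complex" where
  "S_hat N x a1 m1 m2 \<nu>1 \<nu>2 s =
     1 / of_nat N * (\<Sum>n<N. x n * cis (- (2 * pi / N * (m1 + \<nu>1 + s) * n)))
     - A2_hat N x a1 m1 m2 \<nu>1 \<nu>2 / of_nat N *
         ((1 + cis (2 * pi * (\<nu>2 - \<nu>1))) / (1 - cis (2 * pi / N * (of_int (m2 - m1) + \<nu>2 - \<nu>1 - s))))"

definition h1_hat :: "nat \<Rightarrow> (nat \<Rightarrow> complex) \<Rightarrow> complex \<Rightarrow> int \<Rightarrow> int \<Rightarrow> real \<Rightarrow> real \<Rightarrow> complex" where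
  "h1_hat N x a1 m1 m2 \<nu>1 \<nu>2 =
     (let Sp = S_hat N x a1 m1 m2 \<nu>1 \<nu>2 (1/2); Sm = S_hat N x a1 m1 m2 \<nu>1 \<nu>2 (- 1/2)
      in 1 / 2 * ((Sp + Sm) / (Sp - Sm)))"

definition z1_inv :: "nat \<Rightarrow> (nat \<Rightarrow> complex) \<Rightarrow> complex \<Rightarrow> int \<Rightarrow> int \<Rightarrow> real \<Rightarrow> real \<Rightarrow> complex" where
  "z1_inv N x a1 m1 m2 \<nu>1 \<nu>2 =
     of_real (cos (pi / N)) - 2 * \<i> * h1_hat N x a1 m1 m2 \<nu>1 \<nu>2 * of_real (sin (pi / N))"

definition \<delta>1_hat :: "nat \<Rightarrow> (nat \<Rightarrow> complex) \<Rightarrow> complex \<Rightarrow> int \<Rightarrow> int \<Rightarrow> real \<Rightarrow> real \<Rightarrow> real" where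
  "\<delta>1_hat N x a1 m1 m2 \<nu>1 \<nu>2 = \<nu>1 - N / (2 * pi) * Im (ln (z1_inv N x a1 m1 m2 \<nu>1 \<nu>2))"

definition f1_hat :: "nat \<Rightarrow> (nat \<Rightarrow> complex) \<Rightarrow> complex \<Rightarrow> int \<Rightarrow> int \<Rightarrow> real \<Rightarrow> real \<Rightarrow> real" where
  "f1_hat N x a1 m1 m2 \<nu>1 \<nu>2 = (m1 + \<delta>1_hat N x a1 m1 m2 \<nu>1 \<nu>2) / N"

definition dirichlet_factor :: "nat \<Rightarrow> real \<Rightarrow> complex" where
  "dirichlet_factor N t =
     (if t = 0 then 1 else (1 - cis (2 * pi * t)) / (of_nat N * (1 - cis (2 * pi / N * t))))"

definition \<beta> :: "nat \<Rightarrow> int \<Rightarrow> int \<Rightarrow> real \<Rightarrow> real \<Rightarrow> real \<Rightarrow> real \<Rightarrow> complex" where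
  "\<beta> N m1 m2 \<delta>2 \<nu>1 \<nu>2 s =
     (1 + cis (2 * pi * (\<delta>2 - \<nu>1))) / (1 - cis (2 * pi / N * (of_int (m2 - m1) + \<delta>2 - \<nu>1 - s)))
     - dirichlet_factor N (\<delta>2 - \<nu>2) *
       ((1 + cis (2 * pi * (\<nu>2 - \<nu>1))) / (1 - cis (2 * pi / N * (of_int (m2 - m1) + \<nu>2 - \<nu>1 - s))))"

text \<open>The quotient \<open>(d\<^sup>2 - 1/4) / cos (\<pi> d)\<close> has removable singularities at \<open>d = \<plusminus>1/2\<close>, where it is
  read as its limit.\<close>

definition gain :: "real \<Rightarrow> real" where
  "gain d = (if \<bar>d\<bar> = 1/2 then - 1 / pi else (d\<^sup>2 - 1/4) / cos (pi * d))"

text \<open>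
  Two departures from the usual printed form of the bias
  \[ \frac{\pi(d^2-0.25)}{2A_1\cos(\pi d)} \{(1-2d)\,\mathrm{Im}(e^{-j2\pi d}\beta_+)
      + (1+2d)\,\mathrm{Im}(e^{-j2\pi d}\beta_-)\}, \quad d = \delta_1 - \nu_1 : \]
  the amplitude \<open>A1\<close> is complex, so \<open>1 / A1\<close> is placed inside \<open>Im\<close>, which is the same for real
  \<open>A1\<close>; and there is an extra factor \<open>1 / N\<^sup>2\<close>, one \<open>1 / N\<close> coming from the leakage
  \<open>A2 / N * \<beta>\<close> in \<open>S_hat\<close> and one from passing from residuals (in bins) to frequencies.
  Without this factor the expression does not tend to \<open>0\<close> in general, whereas the estimation
  error is of order \<open>N powr (-3/2)\<close>, so that the asymptotic normality would fail.
\<close>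

definition \<mu>_f1 :: "nat \<Rightarrow> complex \<Rightarrow> int \<Rightarrow> int \<Rightarrow> real \<Rightarrow> real \<Rightarrow> real \<Rightarrow> real \<Rightarrow> real" where
  "\<mu>_f1 N A1 m1 m2 \<delta>1 \<delta>2 \<nu>1 \<nu>2 =
     1 / (real N)\<^sup>2 * (pi / 2 * gain (\<delta>1 - \<nu>1) *
       ((1 - 2 * (\<delta>1 - \<nu>1)) * Im (cis (- (2 * pi * (\<delta>1 - \<nu>1))) * \<beta> N m1 m2 \<delta>2 \<nu>1 \<nu>2 (1/2) / A1)
      + (1 + 2 * (\<delta>1 - \<nu>1)) * Im (cis (- (2 * pi * (\<delta>1 - \<nu>1))) * \<beta> N m1 m2 \<delta>2 \<nu>1 \<nu>2 (- 1/2) / A1)))"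

definition var_f1 :: "nat \<Rightarrow> real \<Rightarrow> real \<Rightarrow> real \<Rightarrow> real" where
  "var_f1 N \<rho>1 \<delta>1 \<nu>1 =
     pi\<^sup>2 * (gain (\<delta>1 - \<nu>1))\<^sup>2 / (4 * \<rho>1 * (real N) ^ 3) * (1 + 4 * (\<delta>1 - \<nu>1)\<^sup>2)"

text \<open>\<open>est\<close> is asymptotically normal around \<open>f + \<mu> N\<close> with variance \<open>v N\<close>.\<close>

definition asymp_normal :: "'a measure \<Rightarrow> (nat \<Rightarrow> 'a \<Rightarrow> real) \<Rightarrow> real \<Rightarrow> (nat \<Rightarrow> real) \<Rightarrow> (nat \<Rightarrow> real) \<Rightarrow> bool" where
  "asymp_normal P est f \<mu> v \<longleftrightarrow>
     weak_conv_m (\<lambda>N. distr P borel (\<lambda>\<omega>. (est N \<omega> - f - \<mu> N) / sqrt (v N))) std_normal_distribution"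

end

theory Submission
  imports Defs "HOL-Complex_Analysis.Complex_Analysis" "HOL-Real_Asymp.Real_Asymp"
begin

text \<open>
  Let \<open>d = \<delta>1 - \<nu>1\<close> and write the corrected DFT samples as \<open>S\<^sub>\<plusminus> = A1 * D\<^sub>\<plusminus> + E\<^sub>\<plusminus>\<close>, where \<open>D\<^sub>\<plusminus>\<close>
  is the response of the pure first tone and \<open>E\<^sub>\<plusminus>\<close> consists of a noise average of order \<open>1 / sqrt N\<close>
  and a leakage remainder of order \<open>1 / N\<close>. With \<open>B\<^sub>\<plusminus> = 1 - cis (2 * pi * (d \<mp> 1/2) / N)\<close> the geometric
  sum makes \<open>B\<^sub>\<plusminus> * D\<^sub>\<plusminus>\<close> independent of the sign, so that exactly
  \<open>z1_inv = cis (- 2 * pi * d / N) * (1 + q)\<close> with \<open>q = (B\<^sub>- * E\<^sub>- - B\<^sub>+ * E\<^sub>+) / (S\<^sub>+ - S\<^sub>-)\<close>, and the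
  estimation error is \<open>- Im (ln (1 + q)) / (2 * pi)\<close>. Up to order \<open>1 / N\<^sup>2\<close> this is a fixed real linear
  combination of the noise samples, which is exactly normal with variance \<open>var_f1\<close> because the two
  half-bin frequencies differ by one bin and so are orthogonal. The bias \<open>\<mu>_f1\<close> is itself of order
  \<open>1 / N\<^sup>2\<close>, hence negligible against the standard deviation, which is of order \<open>N powr (-3/2)\<close>.
\<close>

subsection \<open>Weak convergence and Gaussian noise\<close>

text \<open>Levy continuity reduces the claim to characteristic functions. At \<open>t\<close>,
  those of \<open>X n\<close> and \<open>Y n\<close> differ by at most
  \<open>e * \<bar>t\<bar>\<close> plus twice the probability that the two variables are more than
  \<open>e\<close> apart.\<close>

lemma (in prob_space) weak_conv_m_converging_together:
  fixes X Y :: "nat \<Rightarrow> 'a \<Rightarrow> real"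
  assumes [measurable]: "\<And>n. X n \<in> borel_measurable M" "\<And>n. Y n \<in> borel_measurable M"
    and L: "real_distribution L"
    and Y: "weak_conv_m (\<lambda>n. distr M borel (Y n)) L"
    and diff: "\<And>e. e > 0 \<Longrightarrow> (\<lambda>n. prob {\<omega> \<in> space M. \<bar>X n \<omega> - Y n \<omega>\<bar> > e}) \<longlonglongrightarrow> 0"
  shows "weak_conv_m (\<lambda>n. distr M borel (X n)) L"
proof (rule levy_continuity[OF _ L])
  show "real_distribution (distr M borel (X n))" for n by simp
  fix t :: real
  have charY: "(\<lambda>n. char (distr M borel (Y n)) t) \<longlonglongrightarrow> char L t"
    by (rule levy_continuity1[OF _ L Y]) simp
  have "(\<lambda>n. char (distr M borel (X n)) t - char (distr M borel (Y n)) t) \<longlonglongrightarrow> 0"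
  proof (rule LIMSEQ_I)
    fix r :: real assume "r > 0"
    \<comment> \<open>The \<open>+ 1\<close> keeps the quotient meaningful at \<open>t = 0\<close>.
      The budget is \<open>r / 4\<close> for the close part and \<open>2 * (r / 4)\<close> for the
      event \<open>B n\<close>, which stays below \<open>r\<close>.\<close>
    define e where "e = r / (4 * (\<bar>t\<bar> + 1))"
    have "e > 0" using \<open>r > 0\<close> by (simp add: e_def)
    have et: "e * \<bar>t\<bar> \<le> r / 4"
      using \<open>r > 0\<close> by (simp add: e_def field_simps)
    define B where "B n = {\<omega> \<in> space M. \<bar>X n \<omega> - Y n \<omega>\<bar> > e}" for n
    have [measurable]: "B n \<in> sets M" for n unfolding B_def by measurable
    have bound: "norm (char (distr M borel (X n)) t - char (distr M borel (Y n)) t)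
        \<le> e * \<bar>t\<bar> + 2 * prob (B n)" for n
    proof -
      have ptw: "norm (iexp (t * X n \<omega>) - iexp (t * Y n \<omega>)) \<le> e * \<bar>t\<bar> + 2 * indicator (B n) \<omega>"
        if "\<omega> \<in> space M" for \<omega>
      proof (cases "\<omega> \<in> B n")
        case True
        have "norm (iexp (t * X n \<omega>) - iexp (t * Y n \<omega>)) \<le> 1 + 1"
          by (rule order_trans[OF norm_triangle_ineq4]) simp
        moreover have "0 \<le> e * \<bar>t\<bar>" using \<open>e > 0\<close> by simp
        ultimately show ?thesis using True by simp
      next
        case False
        have "iexp (t * X n \<omega>) - iexp (t * Y n \<omega>)
            = iexp (t * Y n \<omega>) * (iexp (t * (X n \<omega> - Y n \<omega>)) - 1)"
          by (simp add: algebra_simps flip: exp_add)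
        then have "norm (iexp (t * X n \<omega>) - iexp (t * Y n \<omega>)) \<le> \<bar>t * (X n \<omega> - Y n \<omega>)\<bar>"
          using iexp_approx1[of "t * (X n \<omega> - Y n \<omega>)" 0] by (simp add: norm_mult)
        also have "\<dots> \<le> \<bar>t\<bar> * e"
          using False that by (auto simp: B_def abs_mult intro!: mult_left_mono)
        finally show ?thesis using False by (simp add: mult.commute)
      qed
      have int_ind: "integrable M (indicat_real (B n))"
        by (rule integrable_real_indicator) (auto simp: emeasure_eq_measure)
      have "char (distr M borel (X n)) t - char (distr M borel (Y n)) t
          = (CLINT \<omega>|M. iexp (t * X n \<omega>) - iexp (t * Y n \<omega>))"
        unfolding char_def
        by (subst (1 2) integral_distr)
          (auto intro!: integrable_iexp Bochner_Integration.integral_diff[symmetric] simp del: of_real_mult)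
      also have "norm \<dots> \<le> (LINT \<omega>|M. norm (iexp (t * X n \<omega>) - iexp (t * Y n \<omega>)))"
        by (rule integral_norm_bound)
      also have "\<dots> \<le> (LINT \<omega>|M. e * \<bar>t\<bar> + 2 * indicator (B n) \<omega>)"
        using int_ind by (intro integral_mono integrable_norm Bochner_Integration.integrable_diff integrable_iexp ptw)
          auto
      also have "\<dots> = e * \<bar>t\<bar> + 2 * prob (B n)"
        using int_ind by (subst Bochner_Integration.integral_add) (auto simp: prob_space)
      finally show ?thesis .
    qed
    have "\<forall>\<^sub>F n in sequentially. prob (B n) < r / 4"
      using diff[OF \<open>e > 0\<close>] \<open>r > 0\<close> by (intro order_tendstoD) (auto simp: B_def)
    then obtain n0 where n0: "\<And>n. n \<ge> n0 \<Longrightarrow> prob (B n) < r / 4"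
      by (auto simp: eventually_sequentially)
    show "\<exists>no. \<forall>n\<ge>no. norm (char (distr M borel (X n)) t - char (distr M borel (Y n)) t - 0) < r"
    proof (intro exI allI impI)
      fix n assume "n \<ge> n0"
      from bound[of n] n0[OF this] et \<open>r > 0\<close>
      show "norm (char (distr M borel (X n)) t - char (distr M borel (Y n)) t - 0) < r" by simp
    qed
  qed
  from tendsto_add[OF this charY]
  show "(\<lambda>n. char (distr M borel (X n)) t) \<longlonglongrightarrow> char L t" by simp
qed

text \<open>A density fixes the law, so the cutoff found for one representative serves every
  variable with that density. Choosing \<open>K\<close> before \<open>X\<close> is what later gives
  one bound for all \<open>N\<close> and all phases.\<close>

lemma (in prob_space) tight_distributed:
  fixes D :: "real \<Rightarrow> ennreal"
  assumes "e > 0"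
  shows "\<exists>K. \<forall>X. distributed M lborel X D \<longrightarrow> prob {\<omega> \<in> space M. \<bar>X \<omega>\<bar> > K} \<le> e"
proof (cases "\<exists>X0. distributed M lborel X0 D")
  case True
  then obtain X0 where X0: "distributed M lborel X0 D" by blast
  then have [measurable]: "X0 \<in> borel_measurable M"
    using distributed_measurable[OF X0] by simp
  have "(\<lambda>n. prob {\<omega> \<in> space M. \<bar>X0 \<omega>\<bar> > real n}) \<longlonglongrightarrow> prob (\<Inter>n. {\<omega> \<in> space M. \<bar>X0 \<omega>\<bar> > real n})"
    by (intro finite_Lim_measure_decseq) (auto simp: decseq_def)
  moreover have "(\<Inter>n. {\<omega> \<in> space M. \<bar>X0 \<omega>\<bar> > real n}) = {}"
  proof (intro equals0I)
    fix \<omega> assume "\<omega> \<in> (\<Inter>n. {\<omega> \<in> space M. \<bar>X0 \<omega>\<bar> > real n})"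
    then have "real n < \<bar>X0 \<omega>\<bar>" for n by blast
    moreover obtain n where "\<bar>X0 \<omega>\<bar> < real n" using reals_Archimedean2 by blast
    ultimately show False by (meson less_asym)
  qed
  ultimately have "(\<lambda>n. prob {\<omega> \<in> space M. \<bar>X0 \<omega>\<bar> > real n}) \<longlonglongrightarrow> 0" by simp
  then have "\<forall>\<^sub>F n in sequentially. prob {\<omega> \<in> space M. \<bar>X0 \<omega>\<bar> > real n} < e"
    using assms by (intro order_tendstoD)
  then obtain n where n: "prob {\<omega> \<in> space M. \<bar>X0 \<omega>\<bar> > real n} < e"
    by (auto simp: eventually_sequentially)
  show ?thesis
  proof (intro exI allI impI)
    fix X assume X: "distributed M lborel X D"
    then have [measurable]: "X \<in> borel_measurable M"
      using distributed_measurable[OF X] by simp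
    have "distr M lborel X = distr M lborel X0"
      using X X0 by (simp add: distributed_distr_eq_density)
    then have "measure (distr M lborel X) {x. \<bar>x\<bar> > real n} = measure (distr M lborel X0) {x. \<bar>x\<bar> > real n}"
      by simp
    then show "prob {\<omega> \<in> space M. \<bar>X \<omega>\<bar> > real n} \<le> e"
      using n by (subst (asm) (1 2) measure_distr) (auto simp: vimage_def Int_def conj_commute)
  qed
qed auto

text \<open>Since \<open>Re (c * w) = Re c * Re w - Im c * Im w\<close>, the sum is a real
  combination of the independent coordinates, and sample \<open>n\<close> contributes the variance
  \<open>(cmod (c n))\<^sup>2 * \<sigma>\<^sup>2 / 2\<close>.\<close>

lemma (in prob_space) white_gaussian_combination:
  assumes w: "white_circular_gaussian M \<sigma> w" and "\<sigma> > 0"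
    and pos: "(\<Sum>n<N. (cmod (c n))\<^sup>2) > 0"
  shows "distributed M lborel (\<lambda>\<omega>. Re (\<Sum>n<N. c n * w n \<omega>))
           (normal_density 0 (\<sigma> / sqrt 2 * sqrt (\<Sum>n<N. (cmod (c n))\<^sup>2)))"
proof -
  define X where "X = (\<lambda>(n::nat, re::bool) \<omega>. if re then Re (w n \<omega>) else Im (w n \<omega>))"
  define k where "k = (\<lambda>(n::nat, re::bool). if re then Re (c n) else - Im (c n))"
  \<comment> \<open>Zero coefficients are dropped because the sum rule for independent normals asks
    for strictly positive standard deviations.\<close>
  define I where "I = {i \<in> {..<N} \<times> UNIV. k i \<noteq> 0}"
  have indep: "indep_vars (\<lambda>_. borel) X UNIV"
    using w unfolding white_circular_gaussian_def X_def by blast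
  have normal: "distributed M lborel (X i) (normal_density 0 (\<sigma> / sqrt 2))" for i
  proof (cases i)
    case (Pair n re)
    then show ?thesis using w by (cases re) (simp_all add: white_circular_gaussian_def X_def)
  qed
  have fin: "finite I" by (simp add: I_def)
  have split: "(\<Sum>i\<in>{..<N} \<times> (UNIV :: bool set). f i) = (\<Sum>n<N. f (n, True) + f (n, False))" for f :: "_ \<Rightarrow> real"
    by (simp add: sum.cartesian_product' UNIV_bool add.commute)
  have k2: "(\<Sum>i\<in>I. (k i)\<^sup>2) = (\<Sum>n<N. (cmod (c n))\<^sup>2)"
  proof -
    have "(\<Sum>i\<in>I. (k i)\<^sup>2) = (\<Sum>i\<in>{..<N} \<times> UNIV. (k i)\<^sup>2)"
      by (intro sum.mono_neutral_left) (auto simp: I_def)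
    then show ?thesis by (simp add: split k_def cmod_power2)
  qed
  have ne: "I \<noteq> {}"
  proof
    assume "I = {}"
    with k2 have "(\<Sum>n<N. (cmod (c n))\<^sup>2) = 0" by (metis sum.empty)
    with pos show False by linarith
  qed
  have "distributed M lborel (\<lambda>\<omega>. \<Sum>i\<in>I. k i * X i \<omega>)
      (normal_density (\<Sum>i\<in>I. 0) (sqrt (\<Sum>i\<in>I. (\<bar>k i\<bar> * (\<sigma> / sqrt 2))\<^sup>2)))"
  proof (rule sum_indep_normal[OF fin ne])
    show "indep_vars (\<lambda>_. borel) (\<lambda>i \<omega>. k i * X i \<omega>) I"
      by (rule indep_vars_compose2[OF indep_vars_subset[OF indep]]) auto
    show "0 < \<bar>k i\<bar> * (\<sigma> / sqrt 2)" if "i \<in> I" for i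
      using that \<open>\<sigma> > 0\<close> by (simp add: I_def)
    show "distributed M lborel (\<lambda>\<omega>. k i * X i \<omega>) (normal_density 0 (\<bar>k i\<bar> * (\<sigma> / sqrt 2)))"
      if "i \<in> I" for i
      using normal_density_affine[OF normal[of i], of "k i" 0] that \<open>\<sigma> > 0\<close> by (simp add: I_def)
  qed
  moreover have "(\<Sum>i\<in>I. k i * X i \<omega>) = Re (\<Sum>n<N. c n * w n \<omega>)" for \<omega>
  proof -
    have "(\<Sum>i\<in>I. k i * X i \<omega>) = (\<Sum>i\<in>{..<N} \<times> UNIV. k i * X i \<omega>)"
      by (intro sum.mono_neutral_left) (auto simp: I_def)
    then show ?thesis by (simp add: split k_def X_def Re_sum)
  qed
  moreover have "sqrt (\<Sum>i\<in>I. (\<bar>k i\<bar> * (\<sigma> / sqrt 2))\<^sup>2) = \<sigma> / sqrt 2 * sqrt (\<Sum>n<N. (cmod (c n))\<^sup>2)"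
  proof -
    have "(\<Sum>i\<in>I. (\<bar>k i\<bar> * (\<sigma> / sqrt 2))\<^sup>2) = (\<sigma> / sqrt 2)\<^sup>2 * (\<Sum>n<N. (cmod (c n))\<^sup>2)"
      by (subst k2[symmetric]) (simp add: power_mult_distrib power_divide sum_distrib_left mult.commute)
    then show ?thesis using \<open>\<sigma> > 0\<close> by (simp add: real_sqrt_mult)
  qed
  ultimately show ?thesis by simp
qed

lemma (in prob_space) white_gaussian_measurable:
  assumes "white_circular_gaussian M \<sigma> w"
  shows "w n \<in> borel_measurable M"
proof -
  have "(\<lambda>\<omega>. Re (w n \<omega>)) \<in> borel_measurable M" "(\<lambda>\<omega>. Im (w n \<omega>)) \<in> borel_measurable M"
    using assms unfolding white_circular_gaussian_def
    by (auto dest!: spec[of _ n] distributed_measurable)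
  then show ?thesis by (subst borel_measurable_complex_iff) auto
qed

text \<open>Unit phases keep the total squared modulus of the coefficients equal to
  \<open>N\<close>. Hence every real projection of the sum, divided by \<open>sqrt N\<close>, has
  the same normal law for all \<open>N\<close> and \<open>\<theta>\<close>, and one tail cutoff
  works uniformly.\<close>

lemma (in prob_space) white_gaussian_mean_tight:
  assumes w: "white_circular_gaussian M \<sigma> w" and "\<sigma> > 0" and "e > 0"
  shows "\<exists>K. \<forall>N\<ge>1. \<forall>\<theta>. prob {\<omega> \<in> space M. cmod (\<Sum>n<N. w n \<omega> * cis (\<theta> n)) > K * sqrt (real N)} \<le> e"
proof -
  obtain K where K: "\<And>X. distributed M lborel X (normal_density 0 (\<sigma> / sqrt 2)) \<Longrightarrow>
      prob {\<omega> \<in> space M. \<bar>X \<omega>\<bar> > K} \<le> e / 2"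
    using tight_distributed[of "e/2"] \<open>e > 0\<close> by auto
  note [measurable] = white_gaussian_measurable[OF w]
  show ?thesis
  proof (intro exI allI impI)
    fix N :: nat and \<theta> :: "nat \<Rightarrow> real" assume N: "N \<ge> 1"
    define S where "S \<omega> = (\<Sum>n<N. w n \<omega> * cis (\<theta> n))" for \<omega>
    have [measurable]: "S \<in> borel_measurable M" unfolding S_def by measurable
    have tail: "prob {\<omega> \<in> space M. \<bar>Re (u * S \<omega>) / sqrt N\<bar> > K} \<le> e / 2" if "cmod u = 1" for u
    proof (rule K)
      have "distributed M lborel (\<lambda>\<omega>. Re (\<Sum>n<N. (u * cis (\<theta> n) / sqrt N) * w n \<omega>))
           (normal_density 0 (\<sigma> / sqrt 2 * sqrt (\<Sum>n<N. (cmod (u * cis (\<theta> n) / sqrt N))\<^sup>2)))"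
        using N that by (intro white_gaussian_combination[OF w \<open>\<sigma> > 0\<close>])
          (simp add: norm_divide norm_mult power_divide)
      moreover have "(\<Sum>n<N. (u * cis (\<theta> n) / sqrt N) * w n \<omega>) = u * S \<omega> / sqrt N" for \<omega>
        by (simp add: S_def sum_distrib_left sum_divide_distrib mult_ac)
      moreover have "(\<Sum>n<N. (cmod (u * cis (\<theta> n) / sqrt N))\<^sup>2) = 1"
        using N that by (simp add: norm_divide norm_mult power_divide)
      ultimately show "distributed M lborel (\<lambda>\<omega>. Re (u * S \<omega>) / sqrt N) (normal_density 0 (\<sigma> / sqrt 2))"
        by (simp only: Re_divide_of_real real_sqrt_one mult_1_right)
    qed
    \<comment> \<open>The rotations \<open>1\<close> and \<open>- \<i>\<close> pick out the real and
      the imaginary part. If neither exceeds \<open>K * sqrt N\<close>, the modulus does not exceed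
      \<open>2 * K * sqrt N\<close>; each event receives half of \<open>e\<close>.\<close>
    have "{\<omega> \<in> space M. cmod (S \<omega>) > (2 * K) * sqrt N}
       \<subseteq> {\<omega> \<in> space M. \<bar>Re (1 * S \<omega>) / sqrt N\<bar> > K} \<union> {\<omega> \<in> space M. \<bar>Re (- \<i> * S \<omega>) / sqrt N\<bar> > K}"
    proof safe
      fix \<omega> assume "2 * K * sqrt N < cmod (S \<omega>)" "\<omega> \<in> space M" "\<not> K < \<bar>Re (- \<i> * S \<omega>) / sqrt N\<bar>"
      moreover have "cmod (S \<omega>) \<le> \<bar>Re (S \<omega>)\<bar> + \<bar>Im (S \<omega>)\<bar>" by (rule cmod_le)
      ultimately show "K < \<bar>Re (1 * S \<omega>) / sqrt N\<bar>" using N by (simp add: field_simps)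
    qed
    then have "prob {\<omega> \<in> space M. cmod (S \<omega>) > (2 * K) * sqrt N}
       \<le> prob ({\<omega> \<in> space M. \<bar>Re (1 * S \<omega>) / sqrt N\<bar> > K} \<union> {\<omega> \<in> space M. \<bar>Re (- \<i> * S \<omega>) / sqrt N\<bar> > K})"
      by (intro finite_measure_mono) auto
    also have "\<dots> \<le> prob {\<omega> \<in> space M. \<bar>Re (1 * S \<omega>) / sqrt N\<bar> > K} + prob {\<omega> \<in> space M. \<bar>Re (- \<i> * S \<omega>) / sqrt N\<bar> > K}"
      by (intro measure_Un_le) measurable
    also have "\<dots> \<le> e"
      using tail[of 1] tail[of "- \<i>"] by simp
    finally show "prob {\<omega> \<in> space M. cmod (\<Sum>n<N. w n \<omega> * cis (\<theta> n)) > (2 * K) * sqrt (real N)} \<le> e"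
      unfolding S_def .
  qed
qed

subsection \<open>Geometric sums of tones\<close>

lemma norm_one_minus_cis_le: "cmod (1 - cis x) \<le> \<bar>x\<bar>"
proof -
  have "cmod (iexp x - 1) \<le> \<bar>x\<bar>" using iexp_approx1[of x 0] by simp
  then show ?thesis by (simp add: cis_conv_exp norm_minus_commute)
qed

lemma norm_one_minus_cis_approx: "cmod (1 - cis x + \<i> * x) \<le> x\<^sup>2 / 2"
proof -
  have "cmod (iexp x - (1 + \<i> * x)) \<le> \<bar>x\<bar>\<^sup>2 / 2"
    using iexp_approx1[of x 1] by (simp add: numeral_2_eq_2)
  moreover have "1 - cis x + \<i> * x = - (iexp x - (1 + \<i> * x))" by (simp add: cis_conv_exp)
  ultimately show ?thesis by (metis norm_minus_cancel power2_abs)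
qed

text \<open>This is the normalised Dirichlet kernel with its phase: the response of the
  \<open>N\<close>-point DFT to a unit tone lying \<open>t\<close> bins from the analysed
  frequency.\<close>

definition mean_tone :: "nat \<Rightarrow> real \<Rightarrow> complex" where
  "mean_tone N t = 1 / of_nat N * (\<Sum>n<N. cis (2 * pi / N * t * real n))"

text \<open>Geometric sum, kept in product form so that it remains valid where the ratio of the
  series is 1.\<close>

lemma mean_tone_mult: "(1 - cis (2 * pi / N * t)) * mean_tone N t = (1 - cis (2 * pi * t)) / of_nat N"
proof (cases "N = 0")
  case False
  have "cis (2 * pi / N * t) ^ n = cis (2 * pi / N * t * real n)" for n
    by (metis Complex.DeMoivre mult.commute)
  then have "(\<Sum>n<N. cis (2 * pi / N * t * real n)) = (\<Sum>n<N. cis (2 * pi / N * t) ^ n)"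
    by simp
  moreover have "cis (2 * pi / N * t) ^ N = cis (2 * pi * t)"
    using False by (simp add: Complex.DeMoivre)
  ultimately show ?thesis
    unfolding mean_tone_def using one_diff_power_eq[of "cis (2 * pi / N * t)" N] by simp
qed (simp add: mean_tone_def)

lemma norm_mean_tone_le: "cmod (mean_tone N t) \<le> 1"
proof -
  have "cmod (\<Sum>n<N. cis (2 * pi / N * t * real n)) \<le> (\<Sum>n<N. 1)"
    by (rule order_trans[OF norm_sum]) simp
  then show ?thesis
    by (cases "N = 0") (simp_all add: mean_tone_def norm_mult norm_divide)
qed

text \<open>The \<open>N\<close>-th roots of unity sum to zero. This is the orthogonality of
  frequencies one bin apart, which removes the cross term from the variance.\<close>

lemma mean_tone_1_eq_0: "N \<ge> 2 \<Longrightarrow> mean_tone N 1 = 0"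
proof -
  assume N: "N \<ge> 2"
  have "cis (2 * pi / N) \<noteq> 1"
  proof
    assume "cis (2 * pi / N) = 1"
    then have "cos (2 * pi / N) = 1" by (metis cis.sel(1) one_complex.sel(1))
    then obtain k :: int where "2 * pi / N = k * 2 * pi" by (auto simp: cos_one_2pi_int)
    then have "real_of_int (k * int N) = real_of_int 1" using N by (simp add: field_simps)
    then have "k * int N = 1" by (simp only: of_int_eq_iff)
    then have "int N dvd 1" by (metis dvd_triv_right)
    then show False using N by simp
  qed
  moreover have "cis (2 * pi) = 1" by (simp add: complex_eq_iff)
  ultimately show ?thesis using mean_tone_mult[of N 1] by simp
qed

text \<open>\<open>tone_integral t\<close> is the integral of \<open>cis (2 * pi * t * u)\<close> over \<open>u \<in> {0..1}\<close>, the limit of the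
  Riemann sums \<open>mean_tone N t\<close>.\<close>

definition tone_integral :: "real \<Rightarrow> complex" where
  "tone_integral t = (if t = 0 then 1 else (1 - cis (2 * pi * t)) / (- (2 * pi * t) * \<i>))"

lemma norm_tone_integral_le: "cmod (tone_integral t) \<le> 1"
  using norm_one_minus_cis_le[of "2 * pi * t"]
  by (auto simp: tone_integral_def norm_divide norm_mult abs_mult divide_le_eq)

lemma mean_tone_approx:
  assumes "N \<ge> 1"
  shows "cmod (mean_tone N t - tone_integral t) \<le> pi * \<bar>t\<bar> / N"
proof (cases "t = 0")
  case True
  then show ?thesis using assms by (simp add: mean_tone_def tone_integral_def)
next
  case False
  define x where "x = 2 * pi / N * t"
  define c where "c = of_real (2 * pi * t) * \<i>"
  have c: "c \<noteq> 0" "cmod c = 2 * pi * \<bar>t\<bar>" using False by (auto simp: c_def norm_mult abs_mult)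
  have x: "of_nat N * (\<i> * of_real x) = c" using assms by (simp add: x_def c_def)
  \<comment> \<open>Multiplying by \<open>c\<close> clears the denominator of
    \<open>tone_integral\<close>. As \<open>c\<close> is \<open>N\<close> times
    \<open>\<i> * x\<close>, inserting the geometric sum leaves only the second-order Taylor
    remainder of \<open>cis x\<close>.\<close>
  have "c * (mean_tone N t - tone_integral t) = c * mean_tone N t + (1 - cis (2 * pi * t))"
    using False by (simp add: c_def tone_integral_def field_simps)
  also have "1 - cis (2 * pi * t) = of_nat N * ((1 - cis x) * mean_tone N t)"
    unfolding x_def mean_tone_mult using assms by simp
  also have "c * mean_tone N t + \<dots> = of_nat N * (1 - cis x + \<i> * x) * mean_tone N t"
    by (simp add: algebra_simps flip: x)
  also have "cmod \<dots> \<le> N * (x\<^sup>2 / 2) * 1"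
    unfolding norm_mult norm_of_nat
    by (intro mult_mono norm_one_minus_cis_approx norm_mean_tone_le) auto
  also have "\<dots> = (2 * pi * \<bar>t\<bar>) * (pi * \<bar>t\<bar> / N)"
    using assms by (simp add: x_def power2_eq_square field_simps)
  finally show ?thesis
    unfolding norm_mult c(2) using False by (subst (asm) mult_le_cancel_left_pos) simp_all
qed

section \<open>Half-bin samples of the limiting tone response and bounds on
  \<open>gain\<close>\<close>

lemma one_plus_cis: "1 + cis (2 * x) = of_real (2 * cos x) * cis x"
  by (auto simp: complex_eq_iff cos_double_cos sin_double power2_eq_square)

lemma cis_half_turn: "\<bar>s\<bar> = 1/2 \<Longrightarrow> cis (2 * pi * (t - s)) = - cis (2 * pi * t)"
  by (auto simp: abs_if complex_eq_iff cos_add sin_add algebra_simps split: if_splits)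

text \<open>Both samples have the numerator \<open>1 + cis (2 * pi * d)\<close>, because a half-bin
  shift in either direction flips the sign of \<open>cis\<close>. The difference of the reciprocals
  of \<open>d - 1/2\<close> and \<open>d + 1/2\<close> then produces \<open>d\<^sup>2 - 1/4\<close>,
  hence \<open>gain\<close>. At \<open>d = 1/2\<close> and \<open>d = - 1/2\<close> one sample is 1,
  the other is 0, and the limiting value in \<open>gain\<close> fits.\<close>

lemma tone_integral_diff:
  "tone_integral (d - 1/2) - tone_integral (d + 1/2) = \<i> * cis (pi * d) / of_real (pi * gain d)"
proof -
  consider "d = 1/2" | "d = - 1/2" | "\<bar>d\<bar> \<noteq> 1/2" by linarith
  then show ?thesis
  proof cases
    case 1
    have "cis (2 * pi) = 1" "cis (pi / 2) = \<i>" by (auto simp: complex_eq_iff)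
    then show ?thesis unfolding 1 by (simp add: tone_integral_def gain_def)
  next
    case 2
    have "cis (- (2 * pi)) = 1" "cis (- (pi / 2)) = - \<i>" by (auto simp: complex_eq_iff)
    then show ?thesis unfolding 2 by (simp add: tone_integral_def gain_def)
  next
    case 3
    define u where "u = complex_of_real (d - 1/2)"
    define v where "v = complex_of_real (d + 1/2)"
    have ne: "u \<noteq> 0" "v \<noteq> 0" using 3 by (auto simp: u_def v_def simp flip: of_real_diff of_real_add)
    have uv: "of_real (d\<^sup>2 - 1/4) = u * v" "v - u = 1"
      by (simp_all add: u_def v_def power2_eq_square algebra_simps flip: of_real_mult)
    define C where "C = of_real (2 * cos (pi * d)) * cis (pi * d)"
    have C: "1 - cis (2 * pi * (d - 1/2)) = C" "1 - cis (2 * pi * (d + 1/2)) = C"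
      using cis_half_turn[of "1/2" d] cis_half_turn[of "- 1/2" d] one_plus_cis[of "pi * d"]
      by (simp_all add: C_def mult_ac)
    have "d - 1/2 \<noteq> 0" "d + 1/2 \<noteq> 0" using 3 by auto
    then have T: "tone_integral (d - 1/2) = C / (- (2 * pi) * u * \<i>)" "tone_integral (d + 1/2) = C / (- (2 * pi) * v * \<i>)"
      unfolding tone_integral_def C u_def v_def by simp_all
    have "tone_integral (d - 1/2) - tone_integral (d + 1/2) = C / (- (2 * pi) * \<i>) * ((v - u) / (u * v))"
      using ne unfolding T by (simp add: field_simps)
    also have "\<dots> = \<i> * cis (pi * d) / of_real (pi * gain d)"
    proof -
      have "of_real (pi * gain d) = of_real pi * (u * v) / of_real (cos (pi * d))"
        using 3 unfolding gain_def by (simp only: if_False of_real_mult of_real_divide uv(1)) simp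
      then show ?thesis unfolding uv(2) using ne by (simp add: C_def field_simps)
    qed
    finally show ?thesis .
  qed
qed

text \<open>The remainder satisfies
  \<open>\<bar>sin x - x\<bar> \<le> \<bar>x\<bar> ^ 3 / 6\<close>, which is at most two thirds of
  \<open>\<bar>x\<bar>\<close> on this range. The radius 2 covers \<open>pi / 2\<close> using only
  \<open>pi < 4\<close>.\<close>

lemma abs_sin_ge: "\<bar>x\<bar> \<le> 2 \<Longrightarrow> \<bar>sin x\<bar> \<ge> \<bar>x\<bar> / 3" for x :: real
proof -
  assume x: "\<bar>x\<bar> \<le> 2"
  have "\<bar>sin x - (\<Sum>m<3. sin_coeff m * x ^ m)\<bar> \<le> inverse (fact 3) * \<bar>x\<bar> ^ 3"
    by (rule Maclaurin_sin_bound)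
  moreover have "(\<Sum>m<3. sin_coeff m * x ^ m) = x"
    by (simp add: eval_nat_numeral sin_coeff_def)
  moreover have "\<bar>x\<bar> ^ 3 \<le> 4 * \<bar>x\<bar>"
    using mult_right_mono[OF power_mono[OF x, of 2], of "\<bar>x\<bar>"] by (simp add: eval_nat_numeral)
  ultimately have "\<bar>sin x - x\<bar> \<le> 2/3 * \<bar>x\<bar>" by (simp add: eval_nat_numeral)
  then show ?thesis by linarith
qed

text \<open>The upper bound makes the limiting denominator \<open>D0\<close> stay away from zero;
  the lower bound keeps the variance from degenerating. The lower one comes from
  \<open>tone_integral_diff\<close>: two numbers of modulus at most 1 differ by at most 2.\<close>

lemma gain_bounds:
  assumes "\<bar>d\<bar> \<le> 1"
  shows "gain d \<noteq> 0" "\<bar>gain d\<bar> \<le> 3/2" "\<bar>gain d\<bar> \<ge> 1 / (2 * pi)"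
proof -
  have *: "gain d \<noteq> 0 \<and> \<bar>gain d\<bar> \<le> 3/2"
  proof (cases "\<bar>d\<bar> = 1/2")
    case True
    then show ?thesis using pi_gt3 by (simp add: gain_def field_simps)
  next
    case False
    \<comment> \<open>Near the removable singularities \<open>u\<close> measures the distance to
      them: the numerator of \<open>gain\<close> is \<open>- u * (1 - u)\<close> and the cosine is
      \<open>sin (pi * u)\<close>, so the vanishing factor cancels.\<close>
    define u where "u = 1/2 - \<bar>d\<bar>"
    have u: "\<bar>u\<bar> \<le> 1/2" "u \<noteq> 0" using assms False unfolding u_def by linarith+
    have "\<bar>pi * u\<bar> \<le> pi * (1/2)"
      unfolding abs_mult using u(1) by (intro mult_mono) auto
    then have "\<bar>pi * u\<bar> \<le> 2" using pi_less_4 by simp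
    then have "\<bar>sin (pi * u)\<bar> \<ge> \<bar>pi * u\<bar> / 3" by (rule abs_sin_ge)
    moreover have "\<bar>pi * u\<bar> \<ge> 3 * \<bar>u\<bar>" using pi_gt3 by (simp add: abs_mult mult_right_mono)
    moreover have "sin (pi * u) = cos (pi * d)"
      by (simp add: u_def right_diff_distrib sin_diff abs_if)
    ultimately have c: "\<bar>cos (pi * d)\<bar> \<ge> \<bar>u\<bar>" by simp
    have "\<bar>d\<bar> = 1/2 - u" by (simp add: u_def)
    then have "\<bar>d\<bar>\<^sup>2 = (1/2 - u)\<^sup>2" by simp
    then have "d\<^sup>2 - 1/4 = - u * (1 - u)" by (simp add: power2_eq_square algebra_simps)
    then have "\<bar>gain d\<bar> = \<bar>u\<bar> * \<bar>1 - u\<bar> / \<bar>cos (pi * d)\<bar>"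
      using False by (simp add: gain_def abs_mult)
    moreover have "0 < \<bar>u\<bar> * \<bar>1 - u\<bar> / \<bar>cos (pi * d)\<bar>" using u c by (intro divide_pos_pos mult_pos_pos) auto
    moreover have "\<bar>u\<bar> * \<bar>1 - u\<bar> \<le> \<bar>cos (pi * d)\<bar> * (3/2)" using u c by (intro mult_mono) auto
    moreover have "\<bar>cos (pi * d)\<bar> > 0" using c u by linarith
    ultimately have "\<bar>gain d\<bar> > 0" "\<bar>gain d\<bar> \<le> 3/2" by (simp_all only: pos_divide_le_eq mult.commute)
    then show ?thesis by simp
  qed
  then show "gain d \<noteq> 0" "\<bar>gain d\<bar> \<le> 3/2" by auto
  have "cmod (\<i> * cis (pi * d) / of_real (pi * gain d)) \<le> 1 + 1"
    unfolding tone_integral_diff[symmetric]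
    by (rule order_trans[OF norm_triangle_ineq4]) (intro add_mono norm_tone_integral_le)
  then show "\<bar>gain d\<bar> \<ge> 1 / (2 * pi)"
    using * by (simp add: norm_divide norm_mult abs_mult field_simps)
qed

subsection \<open>Linearisation of the estimator\<close>

lemma norm_bigo_mono:
  "(\<lambda>N. norm (f N)) \<in> O[F](g) \<Longrightarrow> g \<in> O[F](h) \<Longrightarrow> (\<lambda>N. norm (f N)) \<in> O[F](h :: _ \<Rightarrow> real)"
  by (rule landau_o.big_trans)

lemma norm_bigo_add:
  assumes "(\<lambda>N. norm (f1 N)) \<in> O[F](g)" "(\<lambda>N. norm (f2 N)) \<in> O[F](g :: _ \<Rightarrow> real)"
  shows "(\<lambda>N. norm (f1 N + f2 N)) \<in> O[F](g)"
  by (rule landau_o.big_trans[OF _ sum_in_bigo(1)[OF assms]])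
    (auto intro!: bigoI[where c = 1] always_eventually norm_triangle_ineq)

lemma norm_bigo_diff:
  assumes "(\<lambda>N. norm (f1 N)) \<in> O[F](g)" "(\<lambda>N. norm (f2 N)) \<in> O[F](g :: _ \<Rightarrow> real)"
  shows "(\<lambda>N. norm (f1 N - f2 N)) \<in> O[F](g)"
  using norm_bigo_add[of f1 F g "\<lambda>N. - f2 N"] assms by simp

lemma norm_bigo_mult:
  fixes f1 f2 :: "_ \<Rightarrow> _ :: real_normed_div_algebra"
  assumes "(\<lambda>N. norm (f1 N)) \<in> O[F](g1)" "(\<lambda>N. norm (f2 N)) \<in> O[F](g2)"
    "(\<lambda>N. g1 N * g2 N) \<in> O[F](g :: _ \<Rightarrow> real)"
  shows "(\<lambda>N. norm (f1 N * f2 N)) \<in> O[F](g)"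
  unfolding norm_mult using landau_o.big_mult[OF assms(1,2)] assms(3) by (rule landau_o.big_trans)

lemma norm_bigoI:
  fixes g :: "nat \<Rightarrow> real"
  assumes "\<And>N. N \<ge> 1 \<Longrightarrow> norm (f N) \<le> c * g N" "\<And>N. g N \<ge> 0"
  shows "(\<lambda>N. norm (f N)) \<in> O(g)"
  using assms by (intro bigoI[where c = c] eventually_sequentiallyI[of 1]) auto

text \<open>Once \<open>g N\<close> is within \<open>c / 2\<close> of \<open>f N\<close>, its norm
  is at least \<open>c / 2\<close>. The reference \<open>f\<close> may itself vary with
  \<open>N\<close>, as the limiting denominator does through the residuals.\<close>

lemma norm_bigo_inverse:
  fixes f g :: "nat \<Rightarrow> complex"
  assumes f: "\<And>N. norm (f N) \<ge> c" and "c > 0" and diff: "(\<lambda>N. norm (g N - f N)) \<in> O(h)"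
    and h: "h \<longlonglongrightarrow> (0 :: real)"
  shows "eventually (\<lambda>N. g N \<noteq> 0) sequentially" "(\<lambda>N. norm (inverse (g N))) \<in> O(\<lambda>_. 1)"
proof -
  have "(\<lambda>N. norm (g N - f N)) \<longlonglongrightarrow> 0"
  proof -
    have "h \<in> o(\<lambda>_. 1)" using h by (intro smalloI_tendsto) auto
    from landau_o.big_small_trans[OF diff this] show ?thesis by (auto dest: smalloD_tendsto)
  qed
  then have "\<forall>\<^sub>F N in sequentially. norm (g N - f N) < c / 2"
    using \<open>c > 0\<close> by (intro order_tendstoD) auto
  then have *: "\<forall>\<^sub>F N in sequentially. norm (g N) \<ge> c / 2"
  proof eventually_elim
    case (elim N)
    then show ?case using f[of N] norm_triangle_ineq2[of "f N" "f N - g N"]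
      by (simp add: norm_minus_commute)
  qed
  then show "eventually (\<lambda>N. g N \<noteq> 0) sequentially"
    by eventually_elim (use \<open>c > 0\<close> in auto)
  show "(\<lambda>N. norm (inverse (g N))) \<in> O(\<lambda>_. 1)"
  proof (rule bigoI[where c = "2 / c"])
    show "\<forall>\<^sub>F N in sequentially. norm (norm (inverse (g N))) \<le> 2 / c * norm (1::real)"
      using * by eventually_elim
        (use \<open>c > 0\<close> le_imp_inverse_le[of "c/2" "norm (g _)"] in \<open>auto simp: norm_inverse\<close>)
  qed
qed

text \<open>Only deterministic data are fixed here. For frequencies in this interval the two
  conditions \<open>f_ne\<close> say together that \<open>f1\<close> and \<open>f2\<close> differ
  modulo 1, so that they are distinct discrete-time tones.\<close>

locale two_tone_bins =
  fixes A1 A2 :: complex and f1 f2 :: real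
    and m1 m2 :: "nat \<Rightarrow> int" and \<delta>1 \<delta>2 \<nu>1 \<nu>2 :: "nat \<Rightarrow> real"
  assumes A1: "A1 \<noteq> 0"
    and f1: "f1 \<in> {-1/2..1/2}" and f2: "f2 \<in> {-1/2..1/2}"
    and f_ne: "f1 \<noteq> f2" "\<bar>f1 - f2\<bar> \<noteq> 1"
    and f1_bin: "\<And>N. N \<ge> 1 \<Longrightarrow> f1 = (m1 N + \<delta>1 N) / N" and \<delta>1: "\<And>N. \<delta>1 N \<in> {-1/2..1/2}"
    and f2_bin: "\<And>N. N \<ge> 1 \<Longrightarrow> f2 = (m2 N + \<delta>2 N) / N" and \<delta>2: "\<And>N. \<delta>2 N \<in> {-1/2..1/2}"
    and \<nu>1: "\<And>N. \<nu>1 N \<in> {-1/2..1/2}" and \<nu>2: "\<And>N. \<nu>2 N \<in> {-1/2..1/2}"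
begin

definition d :: "nat \<Rightarrow> real" where "d N = \<delta>1 N - \<nu>1 N"

lemma abs_d_le: "\<bar>d N\<bar> \<le> 1"
  using \<delta>1[of N] \<nu>1[of N] by (auto simp: d_def abs_le_iff)

text \<open>Bins and residuals recombine to the true frequencies: the angle is
  \<open>2 * pi * (f2 - f1)\<close> up to order \<open>1 / N\<close>, and that limit is not a
  multiple of \<open>2 * pi\<close>. This is where the fixed frequency separation enters; it bounds
  every leakage denominator away from zero.\<close>

lemma bin_separation:
  assumes e: "\<And>N. \<bar>e N\<bar> \<le> 3"
  shows "\<forall>\<^sub>F N in sequentially. 1 - cis (2 * pi / N * (real_of_int (m2 N - m1 N) + e N)) \<noteq> 0"
    and "(\<lambda>N. norm (inverse (1 - cis (2 * pi / N * (real_of_int (m2 N - m1 N) + e N))))) \<in> O(\<lambda>_. 1)"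
proof -
  define \<phi> where "\<phi> = 1 - cis (2 * pi * (f2 - f1))"
  define c where "c = (\<lambda>N. 1 - cis (2 * pi / N * (real_of_int (m2 N - m1 N) + e N)))"
  have "\<phi> \<noteq> 0"
  proof
    assume "\<phi> = 0"
    then have "cos (2 * pi * (f2 - f1)) = 1" unfolding \<phi>_def
      by (metis cis.sel(1) eq_iff_diff_eq_0 one_complex.sel(1))
    then obtain k :: int where "2 * pi * (f2 - f1) = k * 2 * pi" by (auto simp: cos_one_2pi_int)
    then have k: "f2 - f1 = k" by simp
    then have "\<bar>real_of_int k\<bar> \<le> 1" using f1 f2 by (auto simp: abs_le_iff)
    then have "k = 0 \<or> \<bar>k\<bar> = 1" by linarith
    then show False using k f_ne by (auto simp: abs_if split: if_splits)
  qed
  have diff: "(\<lambda>N. norm (c N - \<phi>)) \<in> O(\<lambda>N. 1 / real N)"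
  proof (rule norm_bigoI)
    fix N :: nat assume N: "N \<ge> 1"
    define x where "x = 2 * pi / N * (\<delta>1 N - \<delta>2 N + e N)"
    have "2 * pi / N * (real_of_int (m2 N - m1 N) + e N) = 2 * pi * (f2 - f1) + x"
      using N by (simp add: f1_bin[OF N] f2_bin[OF N] x_def field_simps)
    then have "c N - \<phi> = cis (2 * pi * (f2 - f1)) * (1 - cis x)"
      by (simp add: c_def \<phi>_def right_diff_distrib cis_mult)
    then have "norm (c N - \<phi>) \<le> \<bar>x\<bar>" using norm_one_minus_cis_le[of x] by (simp add: norm_mult)
    also have "\<dots> = 2 * pi * \<bar>\<delta>1 N - \<delta>2 N + e N\<bar> * (1 / N)" by (simp add: x_def abs_mult)
    also have "\<dots> \<le> 2 * pi * 4 * (1 / N)"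
      using \<delta>1[of N] \<delta>2[of N] e[of N] by (intro mult_right_mono mult_left_mono) auto
    finally show "norm (c N - \<phi>) \<le> 2 * pi * 4 * (1 / N)" .
  qed auto
  note inv = norm_bigo_inverse[OF order_refl _ diff lim_1_over_n]
  show "\<forall>\<^sub>F N in sequentially. 1 - cis (2 * pi / N * (real_of_int (m2 N - m1 N) + e N)) \<noteq> 0"
    using inv(1) \<open>\<phi> \<noteq> 0\<close> unfolding c_def by simp
  show "(\<lambda>N. norm (inverse (1 - cis (2 * pi / N * (real_of_int (m2 N - m1 N) + e N))))) \<in> O(\<lambda>_. 1)"
    using inv(2) \<open>\<phi> \<noteq> 0\<close> unfolding c_def by simp
qed

text \<open>The noise is a deterministic array here, with a row \<open>v N\<close> for each record
  length. Rows of different lengths may be unrelated, which later permits an adversarial choice for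
  every \<open>N\<close>.\<close>

context
  fixes v :: "nat \<Rightarrow> nat \<Rightarrow> complex" and a :: "nat \<Rightarrow> complex"
begin

definition x :: "nat \<Rightarrow> nat \<Rightarrow> complex" where
  "x N n = A1 * cis (2 * pi * f1 * n) + A2 * cis (2 * pi * f2 * n) + v N n"

definition W :: "nat \<Rightarrow> real \<Rightarrow> complex" where
  "W N t = 1 / of_nat N * (\<Sum>n<N. v N n * cis (- (2 * pi / N * t * n)))"

lemma dft_x:
  assumes N: "N \<ge> 1"
  shows "1 / of_nat N * (\<Sum>n<N. x N n * cis (- (2 * pi / N * t * n)))
    = A1 * mean_tone N (m1 N + \<delta>1 N - t) + A2 * mean_tone N (m2 N + \<delta>2 N - t) + W N t"
proof -
  have "x N n * cis (- (2 * pi / N * t * n)) =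
     A1 * cis (2 * pi / N * (m1 N + \<delta>1 N - t) * n) + A2 * cis (2 * pi / N * (m2 N + \<delta>2 N - t) * n)
     + v N n * cis (- (2 * pi / N * t * n))" for n
  proof -
    have "2 * pi / N * (m1 N + \<delta>1 N - t) * n = 2 * pi * f1 * n + - (2 * pi / N * t * n)"
      using N by (simp add: f1_bin[OF N] field_simps)
    moreover have "2 * pi / N * (m2 N + \<delta>2 N - t) * n = 2 * pi * f2 * n + - (2 * pi / N * t * n)"
      using N by (simp add: f2_bin[OF N] field_simps)
    ultimately show ?thesis
      unfolding x_def by (simp only: distrib_right mult.assoc cis_mult)
  qed
  then show ?thesis
    by (simp add: mean_tone_def W_def sum.distrib distrib_left sum_distrib_left mult_ac)
qed

section \<open>Leakage remainder in the corrected DFT samples\<close>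

definition S :: "real \<Rightarrow> nat \<Rightarrow> complex" where
  "S s N = S_hat N (x N) (a N) (m1 N) (m2 N) (\<nu>1 N) (\<nu>2 N) s"

definition E :: "real \<Rightarrow> nat \<Rightarrow> complex" where
  "E s N = S s N - A1 * mean_tone N (d N - s)"

definition A2h :: "nat \<Rightarrow> complex" where
  "A2h N = A2_hat N (x N) (a N) (m1 N) (m2 N) (\<nu>1 N) (\<nu>2 N)"

text \<open>Averaged unit tones have modulus at most 1, so each term is controlled by its
  coefficient. Boundedness is all the accuracy used below, since \<open>S_hat\<close> multiplies
  this amplitude by a factor of order \<open>1 / N\<close>.\<close>

lemma A2h_bigo:
  assumes a: "(\<lambda>N. norm (a N)) \<in> O(\<lambda>_. 1)" and W: "(\<lambda>N. norm (W N (m2 N + \<nu>2 N))) \<in> O(\<lambda>_. 1)"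
  shows "(\<lambda>N. norm (A2h N)) \<in> O(\<lambda>_. 1)"
proof -
  have m: "(\<lambda>N. norm (mean_tone N (t N))) \<in> O(\<lambda>_. 1)" for t
    using norm_mean_tone_le by (intro norm_bigoI[where c = 1]) auto
  have c: "(\<lambda>N. norm (c :: complex)) \<in> O(\<lambda>_::nat. 1 :: real)" for c by simp
  define t where "t N = m2 N + \<nu>2 N" for N
  have "(\<lambda>N. norm (A1 * mean_tone N (m1 N + \<delta>1 N - t N) + A2 * mean_tone N (m2 N + \<delta>2 N - t N) + W N (t N)
      - a N * mean_tone N (m1 N + \<nu>1 N - t N))) \<in> O(\<lambda>_. 1)"
    using a W by (intro norm_bigo_add norm_bigo_diff norm_bigo_mult[OF c m] norm_bigo_mult[OF a m])
      (simp_all add: t_def)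
  moreover have "A2h N = A1 * mean_tone N (m1 N + \<delta>1 N - t N) + A2 * mean_tone N (m2 N + \<delta>2 N - t N)
      + W N (t N) - a N * mean_tone N (m1 N + \<nu>1 N - t N)" if N: "N \<ge> 1" for N
  proof -
    have "(x N n - a N * cis (2 * pi / N * (m1 N + \<nu>1 N) * n)) * cis (- (2 * pi / N * t N * n))
        = x N n * cis (- (2 * pi / N * t N * n)) - a N * cis (2 * pi / N * (m1 N + \<nu>1 N - t N) * n)" for n :: nat
    proof -
      have "2 * pi / N * (m1 N + \<nu>1 N - t N) * n
          = 2 * pi / N * (m1 N + \<nu>1 N) * n + - (2 * pi / N * t N * n)"
        by (simp add: algebra_simps flip: add_divide_distrib diff_divide_distrib)
      then show ?thesis by (simp only: left_diff_distrib mult.assoc cis_mult)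
    qed
    then have "A2h N = 1 / of_nat N * (\<Sum>n<N. x N n * cis (- (2 * pi / N * t N * n))
        - a N * cis (2 * pi / N * (m1 N + \<nu>1 N - t N) * n))"
      unfolding A2h_def A2_hat_def t_def[symmetric] by simp
    also have "\<dots> = 1 / of_nat N * (\<Sum>n<N. x N n * cis (- (2 * pi / N * t N * n)))
        - a N * mean_tone N (m1 N + \<nu>1 N - t N)"
      by (simp add: sum_subtractf right_diff_distrib sum_distrib_left mean_tone_def mult.left_commute)
    finally have "A2h N = \<dots>" .
    then show ?thesis unfolding dft_x[OF N] .
  qed
  ultimately show ?thesis
    by (subst landau_o.big.in_cong[OF eventually_sequentiallyI[of 1]]) auto
qed

text \<open>The leakage of the second tone and the correction subtracted for it are each of order
  \<open>1 / N\<close>, because both denominators are bounded away from zero. The bound relies on no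
  cancellation between the two.\<close>

lemma E_minus_W_bigo:
  assumes a: "(\<lambda>N. norm (a N)) \<in> O(\<lambda>_. 1)" and W: "(\<lambda>N. norm (W N (m2 N + \<nu>2 N))) \<in> O(\<lambda>_. 1)"
    and s: "\<bar>s\<bar> \<le> 1"
  shows "(\<lambda>N. norm (E s N - W N (m1 N + \<nu>1 N + s))) \<in> O(\<lambda>N. 1 / real N)"
proof -
  define k where "k e N = inverse (1 - cis (2 * pi / N * (real_of_int (m2 N - m1 N) + e)))" for e and N :: nat
  have k: "(\<lambda>N. norm (k (e N) N)) \<in> O(\<lambda>_. 1)" if "\<And>N. \<bar>e N\<bar> \<le> 3" for e
    unfolding k_def using that by (rule bin_separation)
  have c2: "(\<lambda>N. norm (c * (1 + u * cis (\<theta> N)))) \<in> O(\<lambda>_::nat. 1 :: real)" if "norm u = 1" for \<theta> c u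
  proof (rule norm_bigoI[where c = "norm c * (1 + 1)"])
    show "norm (c * (1 + u * cis (\<theta> N))) \<le> norm c * (1 + 1) * 1" for N
      unfolding norm_mult using norm_triangle_ineq[of 1 "u * cis (\<theta> N)"] that
      by (auto simp: norm_mult intro!: mult_left_mono)
  qed simp
  have c1: "(\<lambda>N. norm (1 / of_nat N :: complex)) \<in> O(\<lambda>N. 1 / real N)"
    by (simp add: norm_divide)
  define e1 where "e1 N = \<delta>2 N - \<nu>1 N - s" for N
  define e2 where "e2 N = \<nu>2 N - \<nu>1 N - s" for N
  have e: "\<bar>e1 N\<bar> \<le> 3" "\<bar>e2 N\<bar> \<le> 3" for N
    using \<delta>2[of N] \<nu>1[of N] \<nu>2[of N] s by (auto simp: e1_def e2_def abs_le_iff)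
  \<comment> \<open>The factors \<open>- 1\<close> and \<open>1\<close> are written out so that both
    numerators match the pattern of \<open>c2\<close>.\<close>
  define R where "R N = A2 * (1 + (- 1) * cis (2 * pi * (m2 N - m1 N + e1 N))) * (k (e1 N) N * (1 / of_nat N))
     - A2h N * (1 * (1 + 1 * cis (2 * pi * (\<nu>2 N - \<nu>1 N)))) * (k (e2 N) N * (1 / of_nat N))" for N
  have one: "(\<lambda>N. 1 * 1) \<in> O(\<lambda>_::nat. 1 :: real)" "(\<lambda>N. 1 * (1 / real N)) \<in> O(\<lambda>N. 1 / real N)" by simp_all
  have "(\<lambda>N. norm (R N)) \<in> O(\<lambda>N. 1 / real N)"
    unfolding R_def
    by (intro norm_bigo_diff norm_bigo_mult[OF _ _ one(2)] norm_bigo_mult[OF A2h_bigo[OF a W] _ one(1)] c1 k c2 e) simp_all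
  moreover have "\<forall>\<^sub>F N in sequentially. E s N - W N (m1 N + \<nu>1 N + s) = R N"
    using bin_separation(1)[of e1, OF e(1)] eventually_ge_at_top[of 1]
  proof eventually_elim
    case (elim N)
    define y where "y = real_of_int (m2 N - m1 N) + e1 N"
    have y: "real_of_int (m2 N) + \<delta>2 N - (m1 N + \<nu>1 N + s) = y" by (simp add: y_def e1_def)
    have d: "real_of_int (m1 N) + \<delta>1 N - (m1 N + \<nu>1 N + s) = d N - s" by (simp add: d_def)
    have e2': "real_of_int (m2 N - m1 N) + \<nu>2 N - \<nu>1 N - s = real_of_int (m2 N - m1 N) + e2 N"
      by (simp add: e2_def)
    have "mean_tone N y = (1 - cis (2 * pi * y)) / of_nat N * k (e1 N) N"
    proof -
      define c where "c = 1 - cis (2 * pi / N * y)"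
      have "c \<noteq> 0" using elim(1) by (simp add: c_def y_def)
      moreover have "c * mean_tone N y = (1 - cis (2 * pi * y)) / of_nat N"
        unfolding c_def by (rule mean_tone_mult)
      moreover have "k (e1 N) N = inverse c" by (simp add: k_def c_def y_def)
      ultimately show ?thesis by (metis mult.commute mult.right_neutral mult.assoc right_inverse)
    qed
    moreover have "S s N = A1 * mean_tone N (d N - s) + A2 * mean_tone N y + W N (m1 N + \<nu>1 N + s)
      - A2h N / of_nat N * ((1 + cis (2 * pi * (\<nu>2 N - \<nu>1 N))) * k (e2 N) N)"
      unfolding S_def S_hat_def dft_x[OF elim(2)] y d e2' A2h_def k_def by (simp only: divide_inverse)
    ultimately show ?case by (simp add: E_def R_def y_def mult_ac)
  qed
  ultimately show ?thesis
    by (subst landau_o.big.in_cong) (auto elim: eventually_mono)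
qed


section \<open>Exact factorisation of \<open>z1_inv\<close> and its first-order expansion\<close>

definition D :: "nat \<Rightarrow> complex" where "D N = S (1/2) N - S (- 1/2) N"

text \<open>By \<open>tone_integral_diff\<close> this is \<open>A1\<close> times the difference of
  the two limiting half-bin responses: the noise-free, leakage-free approximation of
  \<open>D\<close>.\<close>

definition D0 :: "nat \<Rightarrow> complex" where "D0 N = A1 * (\<i> * cis (pi * d N) / of_real (pi * gain (d N)))"

definition B :: "real \<Rightarrow> nat \<Rightarrow> complex" where "B s N = 1 - cis (2 * pi / N * (d N - s))"

definition q :: "nat \<Rightarrow> complex" where
  "q N = (B (- 1/2) N * E (- 1/2) N - B (1/2) N * E (1/2) N) / D N"

lemma B_bigo:
  assumes "\<bar>s\<bar> \<le> 1"
  shows "(\<lambda>N. norm (B s N)) \<in> O(\<lambda>N. 1 / real N)"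
    and "(\<lambda>N. norm (B s N + \<i> * of_real (2 * pi / N * (d N - s)))) \<in> O(\<lambda>N. 1 / (real N)\<^sup>2)"
proof -
  have x: "\<bar>2 * pi / N * (d N - s)\<bar> \<le> 4 * pi * (1 / N)" for N :: nat
  proof -
    have "\<bar>2 * pi / N * (d N - s)\<bar> = 2 * pi / N * \<bar>d N - s\<bar>" by (simp add: abs_mult)
    also have "\<dots> \<le> 2 * pi / N * 2" using abs_d_le[of N] assms by (intro mult_left_mono) auto
    finally show ?thesis by simp
  qed
  show "(\<lambda>N. norm (B s N)) \<in> O(\<lambda>N. 1 / real N)"
    unfolding B_def by (rule norm_bigoI[OF order_trans[OF norm_one_minus_cis_le x]]) simp
  show "(\<lambda>N. norm (B s N + \<i> * of_real (2 * pi / N * (d N - s)))) \<in> O(\<lambda>N. 1 / (real N)\<^sup>2)"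
  proof (rule norm_bigoI)
    show "norm (B s N + \<i> * of_real (2 * pi / N * (d N - s))) \<le> (4 * pi)\<^sup>2 / 2 * (1 / (real N)\<^sup>2)" for N
    proof -
      have "norm (B s N + \<i> * of_real (2 * pi / N * (d N - s))) \<le> (2 * pi / N * (d N - s))\<^sup>2 / 2"
        unfolding B_def by (rule norm_one_minus_cis_approx)
      also have "(2 * pi / N * (d N - s))\<^sup>2 \<le> (4 * pi * (1 / N))\<^sup>2"
        using x by (rule power2_le_iff_abs_le[THEN iffD2, rotated]) simp
      finally show ?thesis by (simp add: power_mult_distrib power_divide)
    qed
  qed simp
qed

lemma z1_inv_eq:
  assumes N: "N \<ge> 1" and "D N \<noteq> 0"
  shows "z1_inv N (x N) (a N) (m1 N) (m2 N) (\<nu>1 N) (\<nu>2 N) = cis (- (2 * pi / N * d N)) * (1 + q N)"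
proof -
  define Sp where "Sp = S (1/2) N"
  define Sm where "Sm = S (- 1/2) N"
  define z where "z = z1_inv N (x N) (a N) (m1 N) (m2 N) (\<nu>1 N) (\<nu>2 N)"
  define ph where "ph = cis (2 * pi / N * d N)"
  have ph: "ph * cis (- (2 * pi / N * d N)) = 1" by (simp add: ph_def cis_mult)
  have Bp: "B (1/2) N = 1 - ph * cis (- (pi / N))" and Bm: "B (- 1/2) N = 1 - ph * cis (pi / N)"
    by (simp_all add: B_def ph_def cis_mult right_diff_distrib distrib_left)
  have E: "Sp = A1 * mean_tone N (d N - 1/2) + E (1/2) N" "Sm = A1 * mean_tone N (d N - (- 1/2)) + E (- 1/2) N"
    by (simp_all add: E_def Sp_def Sm_def)
  \<comment> \<open>Both sides equal \<open>(1 + cis (2 * pi * d N)) / of_nat N\<close>; this makes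
    the pure tone drop out of the numerator.\<close>
  have "B (1/2) N * mean_tone N (d N - 1/2) = B (- 1/2) N * mean_tone N (d N - (- 1/2))"
    unfolding B_def mean_tone_mult using cis_half_turn[of "1/2" "d N"] cis_half_turn[of "- 1/2" "d N"] by simp
  then have tone: "B (1/2) N * (A1 * mean_tone N (d N - 1/2)) = B (- 1/2) N * (A1 * mean_tone N (d N - (- 1/2)))"
    by (simp add: mult.left_commute)
  have "z * D N = of_real (cos (pi / N)) * (Sp - Sm) - \<i> * of_real (sin (pi / N)) * (Sp + Sm)"
    using \<open>D N \<noteq> 0\<close> unfolding z_def z1_inv_def h1_hat_def Let_def D_def S_def[symmetric] Sp_def[symmetric] Sm_def[symmetric]
    by (simp add: field_simps)
  also have "\<dots> = cis (- (pi / N)) * Sp - cis (pi / N) * Sm"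
    by (simp add: complex_eq_iff algebra_simps)
  finally have zD: "z * D N = cis (- (pi / N)) * Sp - cis (pi / N) * Sm" .
  \<comment> \<open>Rotation by \<open>ph\<close> turns the coefficients of \<open>Sp\<close> and
    \<open>Sm\<close> into \<open>1 - B\<close>, so the ones reassemble \<open>D N\<close>.\<close>
  have "ph * z * D N = (1 - B (1/2) N) * Sp - (1 - B (- 1/2) N) * Sm"
    unfolding mult.assoc zD Bp Bm by (simp add: algebra_simps)
  also have "\<dots> = D N + (B (- 1/2) N * Sm - B (1/2) N * Sp)"
    by (simp add: D_def Sp_def Sm_def algebra_simps)
  also have "B (- 1/2) N * Sm - B (1/2) N * Sp = B (- 1/2) N * E (- 1/2) N - B (1/2) N * E (1/2) N"
    unfolding E distrib_left tone by simp
  finally have "ph * z = 1 + q N"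
    using \<open>D N \<noteq> 0\<close> by (simp add: q_def field_simps)
  then have "cis (- (2 * pi / N * d N)) * (ph * z) = cis (- (2 * pi / N * d N)) * (1 + q N)" by simp
  moreover have "cis (- (2 * pi / N * d N)) * (ph * z) = z" using ph by (metis mult.assoc mult.commute mult_1)
  ultimately show ?thesis by (simp add: z_def)
qed

text \<open>This is \<open>- Im (q0 N) / (2 * pi)\<close>, where \<open>q0\<close> arises from
  \<open>q\<close> by replacing \<open>D\<close> with \<open>D0\<close>, \<open>E\<close> with the
  noise sample \<open>W\<close>, and \<open>B\<close> with its linear Taylor term. It is real linear
  in the noise.\<close>

definition lin_err :: "nat \<Rightarrow> real" where
  "lin_err N = - (pi * gain (d N) / N) *
     Im (((d N - 1/2) * W N (m1 N + \<nu>1 N + 1/2) - (d N + 1/2) * W N (m1 N + \<nu>1 N + - 1/2)) * cis (- (pi * d N)) / A1)"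

text \<open>Rates: \<open>B\<close> is of order \<open>1 / N\<close>, while \<open>E\<close> and
  \<open>D - D0\<close> are of order \<open>1 / sqrt N\<close>. The errors of order
  \<open>1 / N\<^sup>2\<close> come from \<open>B\<close> times the leakage and from
  \<open>num0\<close> times \<open>D - D0\<close>. The Taylor error of \<open>B\<close> times
  \<open>E\<close> and the quadratic term of the logarithm are smaller.\<close>

lemma f1_hat_linearised:
  assumes a: "(\<lambda>N. norm (a N)) \<in> O(\<lambda>_. 1)" and W2: "(\<lambda>N. norm (W N (m2 N + \<nu>2 N))) \<in> O(\<lambda>_. 1)"
    and Wp: "(\<lambda>N. norm (W N (m1 N + \<nu>1 N + 1/2))) \<in> O(\<lambda>N. 1 / sqrt N)"
    and Wm: "(\<lambda>N. norm (W N (m1 N + \<nu>1 N + - 1/2))) \<in> O(\<lambda>N. 1 / sqrt N)"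
  shows "(\<lambda>N. f1_hat N (x N) (a N) (m1 N) (m2 N) (\<nu>1 N) (\<nu>2 N) - f1 - lin_err N) \<in> O(\<lambda>N. 1 / (real N)\<^sup>2)"
proof -
  define U where "U s N = W N (m1 N + \<nu>1 N + s)" for s N
  have U: "(\<lambda>N. norm (U s N)) \<in> O(\<lambda>N. 1 / sqrt N)" if "s \<in> {1/2, -1/2}" for s
    using that unfolding insert_iff empty_iff
    by (elim disjE) (use Wp Wm in \<open>simp_all only: U_def\<close>)
  have EU: "(\<lambda>N. norm (E s N - U s N)) \<in> O(\<lambda>N. 1 / real N)" if "s \<in> {1/2, -1/2}" for s
    unfolding U_def using that by (intro E_minus_W_bigo[OF a W2]) auto
  have E: "(\<lambda>N. norm (E s N)) \<in> O(\<lambda>N. 1 / sqrt N)" if "s \<in> {1/2, -1/2}" for s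
  proof -
    have "(\<lambda>N. norm (E s N - U s N)) \<in> O(\<lambda>N. 1 / sqrt N)"
      by (rule norm_bigo_mono[OF EU[OF that]]) real_asymp
    from norm_bigo_add[OF this U[OF that]] show ?thesis by simp
  qed
  have mt: "(\<lambda>N. norm (mean_tone N (d N - s) - tone_integral (d N - s))) \<in> O(\<lambda>N. 1 / sqrt N)" if "\<bar>s\<bar> \<le> 1" for s
  proof (rule norm_bigo_mono)
    show "(\<lambda>N. norm (mean_tone N (d N - s) - tone_integral (d N - s))) \<in> O(\<lambda>N. 1 / real N)"
    proof (rule norm_bigoI)
      fix N :: nat assume "N \<ge> 1"
      then have "norm (mean_tone N (d N - s) - tone_integral (d N - s)) \<le> pi * \<bar>d N - s\<bar> / N"
        by (rule mean_tone_approx)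
      also have "\<dots> \<le> pi * 2 / N" using abs_d_le[of N] that by (intro divide_right_mono mult_left_mono) auto
      finally show "norm (mean_tone N (d N - s) - tone_integral (d N - s)) \<le> pi * 2 * (1 / N)" by simp
    qed simp
  qed real_asymp
  have DD0: "(\<lambda>N. norm (D N - D0 N)) \<in> O(\<lambda>N. 1 / sqrt N)"
  proof -
    have "D N - D0 N = A1 * ((mean_tone N (d N - 1/2) - tone_integral (d N - 1/2))
        - (mean_tone N (d N - (- 1/2)) - tone_integral (d N - (- 1/2)))) + (E (1/2) N - E (- 1/2) N)" for N
    proof -
      have "D0 N = A1 * (tone_integral (d N - 1/2) - tone_integral (d N - (- 1/2)))"
        using tone_integral_diff[of "d N"] by (simp add: D0_def)
      then show ?thesis by (simp add: D_def E_def algebra_simps)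
    qed
    moreover have "(\<lambda>N. norm (A1 * ((mean_tone N (d N - 1/2) - tone_integral (d N - 1/2))
        - (mean_tone N (d N - (- 1/2)) - tone_integral (d N - (- 1/2)))) + (E (1/2) N - E (- 1/2) N))) \<in> O(\<lambda>N. 1 / sqrt N)"
    proof (rule norm_bigo_add)
      show "(\<lambda>N. norm (E (1/2) N - E (- 1/2) N)) \<in> O(\<lambda>N. 1 / sqrt N)"
        by (intro norm_bigo_diff E) auto
      have "(\<lambda>N::nat. norm A1) \<in> O(\<lambda>_. 1)" by simp
      moreover have "(\<lambda>N. norm ((mean_tone N (d N - 1/2) - tone_integral (d N - 1/2))
        - (mean_tone N (d N - (- 1/2)) - tone_integral (d N - (- 1/2))))) \<in> O(\<lambda>N. 1 / sqrt N)"
        by (intro norm_bigo_diff[OF mt mt]) auto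
      ultimately show "(\<lambda>N. norm (A1 * ((mean_tone N (d N - 1/2) - tone_integral (d N - 1/2))
        - (mean_tone N (d N - (- 1/2)) - tone_integral (d N - (- 1/2)))))) \<in> O(\<lambda>N. 1 / sqrt N)"
        by (rule norm_bigo_mult) simp
    qed
    ultimately show ?thesis by simp
  qed
  \<comment> \<open>The constant comes from \<open>\<bar>gain (d N)\<bar> \<le> 3/2\<close>.\<close>
  define c where "c = norm A1 / (pi * (3/2))"
  have "c > 0" using A1 by (simp add: c_def)
  have D0_ge: "norm (D0 N) \<ge> c" for N
  proof -
    have "norm (D0 N) = norm A1 / (pi * \<bar>gain (d N)\<bar>)"
      by (simp add: D0_def norm_mult norm_divide abs_mult)
    moreover have "0 < pi * \<bar>gain (d N)\<bar>" "pi * \<bar>gain (d N)\<bar> \<le> pi * (3/2)"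
      using gain_bounds[OF abs_d_le[of N]] by (simp, intro mult_left_mono) auto
    ultimately show ?thesis unfolding c_def by (simp only:) (intro divide_left_mono; simp)
  qed
  have lim: "(\<lambda>N. 1 / sqrt (real N)) \<longlonglongrightarrow> 0" by real_asymp
  note D_inv = norm_bigo_inverse[OF D0_ge \<open>c > 0\<close> DD0 lim]
  have D0_inv: "(\<lambda>N. norm (inverse (D0 N))) \<in> O(\<lambda>_. 1)"
    by (rule norm_bigo_inverse(2)[where f = D0 and g = D0, OF D0_ge \<open>c > 0\<close> _ lim]) simp
  define t where "t s N = \<i> * complex_of_real (2 * pi / N * (d N - s))" for s and N :: nat
  define num where "num N = B (- 1/2) N * E (- 1/2) N - B (1/2) N * E (1/2) N" for N
  define num0 where "num0 N = t (1/2) N * U (1/2) N - t (- 1/2) N * U (- 1/2) N" for N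
  have t: "(\<lambda>N. norm (t s N)) \<in> O(\<lambda>N. 1 / real N)" if "\<bar>s\<bar> \<le> 1" for s
  proof -
    have "t s N = (B s N + \<i> * of_real (2 * pi / N * (d N - s))) - B s N" for N
      by (simp add: t_def)
    moreover have "(\<lambda>N. norm ((B s N + \<i> * of_real (2 * pi / N * (d N - s))) - B s N)) \<in> O(\<lambda>N. 1 / real N)"
    proof (rule norm_bigo_diff[OF norm_bigo_mono[OF B_bigo(2)[OF that]] B_bigo(1)[OF that]])
      show "(\<lambda>N. 1 / (real N)\<^sup>2) \<in> O(\<lambda>N. 1 / real N)" by real_asymp
    qed
    ultimately show ?thesis by simp
  qed
  have num0: "(\<lambda>N. norm (num0 N)) \<in> O(\<lambda>N. 1 / real N * (1 / sqrt N))"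
    unfolding num0_def by (intro norm_bigo_diff norm_bigo_mult[OF t U]) auto
  have num_diff: "(\<lambda>N. norm (num N - num0 N)) \<in> O(\<lambda>N. 1 / (real N)\<^sup>2)"
  proof -
    have part: "(\<lambda>N. norm (B s N * E s N + t s N * U s N)) \<in> O(\<lambda>N. 1 / (real N)\<^sup>2)" if s: "s \<in> {1/2, -1/2}" for s
    proof -
      have s': "\<bar>s\<bar> \<le> 1" using s by auto
      \<comment> \<open>The minus sign of the Taylor term of \<open>B\<close> is absorbed in
        \<open>t\<close>, so \<open>B + t\<close> is already second order. What remains pairs
        \<open>t\<close> with the leakage \<open>E - U\<close>.\<close>
      have "B s N * E s N + t s N * U s N = (B s N + t s N) * E s N - t s N * (E s N - U s N)" for N
        by (simp add: algebra_simps)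
      moreover have "(\<lambda>N. norm ((B s N + t s N) * E s N - t s N * (E s N - U s N))) \<in> O(\<lambda>N. 1 / (real N)\<^sup>2)"
      proof (intro norm_bigo_diff)
        show "(\<lambda>N. norm ((B s N + t s N) * E s N)) \<in> O(\<lambda>N. 1 / (real N)\<^sup>2)"
          by (rule norm_bigo_mult[OF _ E[OF s]], unfold t_def, rule B_bigo(2)[OF s']) real_asymp
        show "(\<lambda>N. norm (t s N * (E s N - U s N))) \<in> O(\<lambda>N. 1 / (real N)\<^sup>2)"
          by (rule norm_bigo_mult[OF t[OF s'] EU[OF s]]) real_asymp
      qed
      ultimately show ?thesis by simp
    qed
    have "num N - num0 N = (B (- 1/2) N * E (- 1/2) N + t (- 1/2) N * U (- 1/2) N)
        - (B (1/2) N * E (1/2) N + t (1/2) N * U (1/2) N)" for N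
      by (simp add: num_def num0_def)
    then show ?thesis using norm_bigo_diff[OF part[of "- 1/2"] part[of "1/2"]] by simp
  qed
  define q0 where "q0 N = num0 N / D0 N" for N
  have q_diff: "(\<lambda>N. norm (q N - q0 N)) \<in> O(\<lambda>N. 1 / (real N)\<^sup>2)"
  proof -
    \<comment> \<open>The quotient difference is split so that the numerator error meets a bounded
      inverse, and the denominator error meets the small \<open>num0\<close>.\<close>
    have "(\<lambda>N. norm ((num N - num0 N) * inverse (D N)
       - num0 N * ((D N - D0 N) * (inverse (D N) * inverse (D0 N))))) \<in> O(\<lambda>N. 1 / (real N)\<^sup>2)"
    proof (intro norm_bigo_diff)
      show "(\<lambda>N. norm ((num N - num0 N) * inverse (D N))) \<in> O(\<lambda>N. 1 / (real N)\<^sup>2)"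
        by (rule norm_bigo_mult[OF num_diff D_inv(2)]) simp
      have "(\<lambda>N. norm (inverse (D N) * inverse (D0 N))) \<in> O(\<lambda>_. 1)"
        by (rule norm_bigo_mult[OF D_inv(2) D0_inv]) simp
      then have "(\<lambda>N. norm ((D N - D0 N) * (inverse (D N) * inverse (D0 N)))) \<in> O(\<lambda>N. 1 / sqrt N)"
        by (rule norm_bigo_mult[OF DD0]) simp
      then show "(\<lambda>N. norm (num0 N * ((D N - D0 N) * (inverse (D N) * inverse (D0 N))))) \<in> O(\<lambda>N. 1 / (real N)\<^sup>2)"
        by (rule norm_bigo_mult[OF num0]) real_asymp
    qed
    moreover have "\<forall>\<^sub>F N in sequentially. q N - q0 N = (num N - num0 N) * inverse (D N)
       - num0 N * ((D N - D0 N) * (inverse (D N) * inverse (D0 N)))"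
      using D_inv(1)
    proof eventually_elim
      case (elim N)
      have "D0 N \<noteq> 0" using D0_ge[of N] \<open>c > 0\<close> by auto
      moreover have "q N = num N / D N" by (simp only: q_def num_def)
      ultimately show ?case using elim by (simp add: q0_def field_simps)
    qed
    ultimately show ?thesis by (subst landau_o.big.in_cong) (auto elim: eventually_mono)
  qed
  have q0: "(\<lambda>N. norm (q0 N)) \<in> O(\<lambda>N. 1 / real N * (1 / sqrt N))"
    unfolding q0_def divide_inverse[of _ "D0 _"] by (rule norm_bigo_mult[OF num0 D0_inv]) simp
  have q: "(\<lambda>N. norm (q N)) \<in> O(\<lambda>N. 1 / real N * (1 / sqrt N))"
  proof -
    have "(\<lambda>N. norm (q N - q0 N)) \<in> O(\<lambda>N. 1 / real N * (1 / sqrt N))"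
      by (rule norm_bigo_mono[OF q_diff]) real_asymp
    from norm_bigo_add[OF this q0] show ?thesis by simp
  qed
  have "(\<lambda>N. norm (q N)) \<longlonglongrightarrow> 0"
  proof -
    have "(\<lambda>N. 1 / real N * (1 / sqrt N)) \<in> o(\<lambda>_. 1)" by real_asymp
    from landau_o.big_small_trans[OF q this] show ?thesis by (auto dest: smalloD_tendsto)
  qed
  then have q_small: "\<forall>\<^sub>F N in sequentially. norm (q N) < 1/2"
    by (rule order_tendstoD) simp
  have ln_q: "(\<lambda>N. norm (ln (1 + q N) - q N)) \<in> O(\<lambda>N. 1 / (real N)\<^sup>2)"
  proof -
    have "(\<lambda>N. norm (ln (1 + q N) - q N)) \<in> O(\<lambda>N. norm (q N * q N))"
    proof (rule bigoI[where c = 2], use q_small in eventually_elim)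
      case (elim N)
      have "norm (ln (1 + q N) - q N) \<le> (norm (q N))\<^sup>2 / (1 - norm (q N))"
        using elim by (intro Ln_approx_linear) simp
      also have "\<dots> \<le> (norm (q N))\<^sup>2 / (1/2)"
        using elim by (intro divide_left_mono) auto
      finally show ?case by (simp add: norm_mult power2_eq_square)
    qed
    also have "(\<lambda>N. norm (q N * q N)) \<in> O(\<lambda>N. 1 / (real N)\<^sup>2)"
      by (rule norm_bigo_mult[OF q q]) real_asymp
    finally show ?thesis .
  qed
  have lnq0: "(\<lambda>N. norm (ln (1 + q N) - q0 N)) \<in> O(\<lambda>N. 1 / (real N)\<^sup>2)"
    using norm_bigo_add[OF ln_q q_diff] by simp
  have lin: "lin_err N = - (1 / (2 * pi)) * Im (q0 N)" if "N \<ge> 1" for N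
  proof -
    define V where "V = (d N - 1/2) * W N (m1 N + \<nu>1 N + 1/2) - (d N + 1/2) * W N (m1 N + \<nu>1 N + - 1/2)"
    have g: "complex_of_real (gain (d N)) \<noteq> 0" using gain_bounds[OF abs_d_le[of N]] by simp
    have "num0 N = \<i> * of_real (2 * pi / N) * V"
      by (simp add: num0_def t_def U_def V_def algebra_simps)
    moreover have "inverse (cis (pi * d N)) = cis (- (pi * d N))" by simp
    ultimately have "q0 N = of_real (2 * pi / N * (pi * gain (d N))) * (V * cis (- (pi * d N)) / A1)"
      using g A1 that by (simp add: q0_def D0_def field_simps)
    then have "Im (q0 N) = (2 * pi / N * (pi * gain (d N))) * Im (V * cis (- (pi * d N)) / A1)"
      by (simp only: times_complex.sel Re_complex_of_real Im_complex_of_real mult_zero_left add_0_right)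
    then show ?thesis by (simp add: lin_err_def V_def)
  qed
  have f: "\<forall>\<^sub>F N in sequentially. f1_hat N (x N) (a N) (m1 N) (m2 N) (\<nu>1 N) (\<nu>2 N) - f1 - lin_err N
      = - (1 / (2 * pi)) * Im (ln (1 + q N) - q0 N)"
    using D_inv(1) q_small eventually_ge_at_top[of 3]
  proof eventually_elim
    case (elim N)
    define L where "L = ln (1 + q N)"
    define y where "y = 2 * pi / N * d N"
    have N: "N \<ge> 1" using elim by simp
    have ne: "1 + q N \<noteq> 0"
    proof
      assume "1 + q N = 0"
      then have "q N = - 1" by (simp add: add_eq_0_iff)
      then show False using elim(2) by simp
    qed
    have "\<bar>Im L\<bar> \<le> norm L" by (rule abs_Im_le_cmod)
    also have "\<dots> \<le> 2 * norm (q N)" unfolding L_def using elim(2) by (rule norm_Ln_le)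
    finally have ImL: "\<bar>Im L\<bar> < 1" using elim(2) by simp
    have "\<bar>y\<bar> = 2 * pi * \<bar>d N\<bar> / N" by (simp add: y_def abs_mult)
    also have "\<dots> \<le> 2 * pi * 1 / 3" using elim(3) abs_d_le[of N] by (intro frac_le mult_left_mono) auto
    finally have y: "\<bar>y\<bar> \<le> 2 * pi / 3" by simp
    \<comment> \<open>The principal branch splits over the product because
      \<open>\<bar>Im L\<bar> < 1\<close> and \<open>\<bar>y\<bar> \<le> 2 * pi / 3\<close>, whose
      sum is below \<open>pi\<close>. This is the reason for starting at
      \<open>N = 3\<close>.\<close>
    have "ln (z1_inv N (x N) (a N) (m1 N) (m2 N) (\<nu>1 N) (\<nu>2 N)) = L - \<i> * y"
    proof (rule Ln_unique)
      show "exp (L - \<i> * y) = z1_inv N (x N) (a N) (m1 N) (m2 N) (\<nu>1 N) (\<nu>2 N)"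
        unfolding z1_inv_eq[OF N elim(1)] y_def[symmetric] L_def
        using ne by (simp add: exp_diff cis_conv_exp exp_minus field_simps)
      show "- pi < Im (L - \<i> * y)" "Im (L - \<i> * y) \<le> pi"
        using ImL y pi_gt3 by (auto simp: abs_less_iff abs_le_iff)
    qed
    then have "f1_hat N (x N) (a N) (m1 N) (m2 N) (\<nu>1 N) (\<nu>2 N) = (m1 N + (\<nu>1 N - N / (2 * pi) * (Im L - y))) / N"
      by (simp add: f1_hat_def \<delta>1_hat_def)
    \<comment> \<open>The rotation \<open>y\<close> contributes exactly \<open>d N\<close> bins,
      which moves \<open>\<nu>1\<close> to the true residual and leaves only
      \<open>Im L\<close>.\<close>
    also have "\<dots> - f1 = - (1 / (2 * pi)) * Im L"
      using N unfolding f1_bin[OF N] by (simp add: y_def d_def field_simps)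
    finally show ?case unfolding lin[OF N] L_def by (simp add: algebra_simps)
  qed
  have "(\<lambda>N. - (1 / (2 * pi)) * Im (ln (1 + q N) - q0 N)) \<in> O(\<lambda>N. norm (ln (1 + q N) - q0 N))"
    by (intro bigoI[where c = "1 / (2 * pi)"] always_eventually allI)
      (simp add: abs_mult divide_right_mono abs_Im_le_cmod del: minus_complex.sel)
  from landau_o.big_trans[OF this lnq0] show ?thesis
    by (subst landau_o.big.in_cong[OF f])
qed

end

end

subsection \<open>Asymptotic normality\<close>

text \<open>Away from zero denominators the factor is \<open>mean_tone\<close>. If the denominator
  vanishes at some nonzero \<open>t\<close>, division yields 0.\<close>

lemma norm_dirichlet_factor_le: "cmod (dirichlet_factor N t) \<le> 1"
proof -
  define c where "c = 1 - cis (2 * pi / N * t)"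
  consider "t = 0" | "t \<noteq> 0" "c = 0" | "t \<noteq> 0" "c \<noteq> 0" by blast
  then show ?thesis
  proof cases
    case 3
    have "c * mean_tone N t = (1 - cis (2 * pi * t)) / of_nat N"
      unfolding c_def by (rule mean_tone_mult)
    then have "dirichlet_factor N t = mean_tone N t"
      unfolding dirichlet_factor_def c_def[symmetric] using 3
      by (metis divide_divide_eq_left nonzero_mult_div_cancel_left)
    then show ?thesis using norm_mean_tone_le by simp
  qed (simp_all add: dirichlet_factor_def c_def)
qed

context two_tone_bins
begin

text \<open>Numerators and Dirichlet factor are bounded, and \<open>bin_separation\<close> bounds
  the inverses. The explicit \<open>1 / N\<^sup>2\<close> in the bias is therefore its actual rate
  bound.\<close>

lemma \<beta>_bigo:
  assumes s: "\<bar>s\<bar> \<le> 1"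
  shows "(\<lambda>N. norm (\<beta> N (m1 N) (m2 N) (\<delta>2 N) (\<nu>1 N) (\<nu>2 N) s)) \<in> O(\<lambda>_. 1)"
proof -
  define k where "k e N = inverse (1 - cis (2 * pi / N * (real_of_int (m2 N - m1 N) + e)))" for e and N :: nat
  have k: "(\<lambda>N. norm (k (e N) N)) \<in> O(\<lambda>_. 1)" if "\<And>N. \<bar>e N\<bar> \<le> 3" for e
    unfolding k_def using that by (rule bin_separation)
  have c: "(\<lambda>N. norm (1 + cis (\<theta> N))) \<in> O(\<lambda>_::nat. 1 :: real)" for \<theta>
    using norm_triangle_ineq[of 1 "cis (\<theta> _)"] by (intro norm_bigoI[where c = 2]) auto
  have D: "(\<lambda>N. norm (dirichlet_factor N (\<delta>2 N - \<nu>2 N))) \<in> O(\<lambda>_. 1)"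
    using norm_dirichlet_factor_le by (intro norm_bigoI[where c = 1]) auto
  define e1 where "e1 N = \<delta>2 N - \<nu>1 N - s" for N
  define e2 where "e2 N = \<nu>2 N - \<nu>1 N - s" for N
  have e: "\<bar>e1 N\<bar> \<le> 3" "\<bar>e2 N\<bar> \<le> 3" for N
    using \<delta>2[of N] \<nu>1[of N] \<nu>2[of N] s by (auto simp: e1_def e2_def abs_le_iff)
  have "\<beta> N (m1 N) (m2 N) (\<delta>2 N) (\<nu>1 N) (\<nu>2 N) s = (1 + cis (2 * pi * (\<delta>2 N - \<nu>1 N))) * k (e1 N) N
      - dirichlet_factor N (\<delta>2 N - \<nu>2 N) * ((1 + cis (2 * pi * (\<nu>2 N - \<nu>1 N))) * k (e2 N) N)" for N
  proof -
    have "real_of_int (m2 N - m1 N) + \<delta>2 N - \<nu>1 N - s = real_of_int (m2 N - m1 N) + e1 N"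
      "real_of_int (m2 N - m1 N) + \<nu>2 N - \<nu>1 N - s = real_of_int (m2 N - m1 N) + e2 N"
      by (simp_all add: e1_def e2_def)
    then show ?thesis unfolding \<beta>_def k_def by (simp only: divide_inverse)
  qed
  moreover have "(\<lambda>N. norm ((1 + cis (2 * pi * (\<delta>2 N - \<nu>1 N))) * k (e1 N) N
      - dirichlet_factor N (\<delta>2 N - \<nu>2 N) * ((1 + cis (2 * pi * (\<nu>2 N - \<nu>1 N))) * k (e2 N) N))) \<in> O(\<lambda>_. 1)"
  proof (rule norm_bigo_diff)
    show "(\<lambda>N. norm ((1 + cis (2 * pi * (\<delta>2 N - \<nu>1 N))) * k (e1 N) N)) \<in> O(\<lambda>_. 1)"
      by (rule norm_bigo_mult[OF c k[OF e(1)]]) simp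
    have "(\<lambda>N. norm ((1 + cis (2 * pi * (\<nu>2 N - \<nu>1 N))) * k (e2 N) N)) \<in> O(\<lambda>_. 1)"
      by (rule norm_bigo_mult[OF c k[OF e(2)]]) simp
    then show "(\<lambda>N. norm (dirichlet_factor N (\<delta>2 N - \<nu>2 N)
        * ((1 + cis (2 * pi * (\<nu>2 N - \<nu>1 N))) * k (e2 N) N))) \<in> O(\<lambda>_. 1)"
      by (rule norm_bigo_mult[OF D]) simp
  qed
  ultimately show ?thesis by simp
qed

lemma \<mu>_f1_bigo: "(\<lambda>N. \<mu>_f1 N A1 (m1 N) (m2 N) (\<delta>1 N) (\<delta>2 N) (\<nu>1 N) (\<nu>2 N)) \<in> O(\<lambda>N. 1 / (real N)\<^sup>2)"
proof -
  have bounded: "c \<in> O(\<lambda>_. 1)" if "\<And>N. \<bar>c N\<bar> \<le> C" for c :: "nat \<Rightarrow> real" and C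
    using that by (intro bigoI[where c = C]) auto
  have im: "(\<lambda>N. c N * Im (cis (\<theta> N) * \<beta> N (m1 N) (m2 N) (\<delta>2 N) (\<nu>1 N) (\<nu>2 N) s / A1)) \<in> O(\<lambda>_. 1)"
    if s: "\<bar>s\<bar> \<le> 1" and c: "\<And>N. \<bar>c N\<bar> \<le> 3" for c \<theta> s
  proof -
    have "(\<lambda>N. Im (cis (\<theta> N) * \<beta> N (m1 N) (m2 N) (\<delta>2 N) (\<nu>1 N) (\<nu>2 N) s / A1))
        \<in> O(\<lambda>N. norm (\<beta> N (m1 N) (m2 N) (\<delta>2 N) (\<nu>1 N) (\<nu>2 N) s))"
    proof (intro bigoI[where c = "1 / norm A1"] always_eventually allI)
      fix N
      have "\<bar>Im (cis (\<theta> N) * \<beta> N (m1 N) (m2 N) (\<delta>2 N) (\<nu>1 N) (\<nu>2 N) s / A1)\<bar>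
          \<le> norm (cis (\<theta> N) * \<beta> N (m1 N) (m2 N) (\<delta>2 N) (\<nu>1 N) (\<nu>2 N) s / A1)" by (rule abs_Im_le_cmod)
      then show "norm (Im (cis (\<theta> N) * \<beta> N (m1 N) (m2 N) (\<delta>2 N) (\<nu>1 N) (\<nu>2 N) s / A1))
          \<le> 1 / norm A1 * norm (norm (\<beta> N (m1 N) (m2 N) (\<delta>2 N) (\<nu>1 N) (\<nu>2 N) s))"
        by (simp only: norm_mult norm_divide norm_cis real_norm_def abs_norm_cancel) simp
    qed
    from landau_o.big_mult[OF bounded[OF c] landau_o.big_trans[OF this \<beta>_bigo[OF s]]] show ?thesis by simp
  qed
  have d: "\<bar>1 - 2 * d N\<bar> \<le> 3" "\<bar>1 + 2 * d N\<bar> \<le> 3" for N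
    using abs_d_le[of N] by (auto simp: abs_le_iff)
  have "\<bar>pi / 2 * gain (d N)\<bar> \<le> pi / 2 * (3/2)" for N
    unfolding abs_mult using gain_bounds(2)[OF abs_d_le] by (intro mult_mono) auto
  then have g: "(\<lambda>N. pi / 2 * gain (d N)) \<in> O(\<lambda>_. 1)" by (rule bounded)
  have "(\<lambda>N::nat. 1 / (real N)\<^sup>2) \<in> O(\<lambda>N. 1 / (real N)\<^sup>2)" by simp
  from landau_o.big_mult[OF this landau_o.big_mult[OF g sum_in_bigo(1)[OF im im]]]
  show ?thesis unfolding \<mu>_f1_def d_def[symmetric]
    using d by simp
qed

text \<open>The lower bound on \<open>gain\<close> makes the standard deviation at least a constant
  times \<open>N powr (-3/2)\<close>. Dividing the linearisation error and the bias, both of order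
  \<open>1 / N\<^sup>2\<close>, leaves order \<open>1 / sqrt N\<close>.\<close>

lemma f1_hat_standardised:
  fixes \<sigma> :: real
  assumes "\<sigma> > 0"
    and a: "(\<lambda>N. norm (a N)) \<in> O(\<lambda>_. 1)" and W2: "(\<lambda>N. norm (W v N (m2 N + \<nu>2 N))) \<in> O(\<lambda>_. 1)"
    and Wp: "(\<lambda>N. norm (W v N (m1 N + \<nu>1 N + 1/2))) \<in> O(\<lambda>N. 1 / sqrt N)"
    and Wm: "(\<lambda>N. norm (W v N (m1 N + \<nu>1 N + - 1/2))) \<in> O(\<lambda>N. 1 / sqrt N)"
  shows "(\<lambda>N. (f1_hat N (x v N) (a N) (m1 N) (m2 N) (\<nu>1 N) (\<nu>2 N) - f1
            - \<mu>_f1 N A1 (m1 N) (m2 N) (\<delta>1 N) (\<delta>2 N) (\<nu>1 N) (\<nu>2 N)) / sqrt (var_f1 N ((cmod A1)\<^sup>2 / \<sigma>\<^sup>2) (\<delta>1 N) (\<nu>1 N))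
          - lin_err v N / sqrt (var_f1 N ((cmod A1)\<^sup>2 / \<sigma>\<^sup>2) (\<delta>1 N) (\<nu>1 N))) \<longlonglongrightarrow> 0"
    (is "(\<lambda>N. (?f N - f1 - ?\<mu> N) / sqrt (?v N) - lin_err v N / sqrt (?v N)) \<longlonglongrightarrow> 0")
proof -
  define \<rho> where "\<rho> = (cmod A1)\<^sup>2 / \<sigma>\<^sup>2"
  have \<rho>: "\<rho> > 0" using A1 \<open>\<sigma> > 0\<close> by (simp add: \<rho>_def)
  have "(\<lambda>N. inverse (sqrt (?v N))) \<in> O(\<lambda>N. real N * sqrt N)"
  proof (rule bigoI[where c = "4 * sqrt \<rho>"], rule eventually_sequentiallyI[of 1])
    fix N :: nat assume N: "N \<ge> 1"
    \<comment> \<open>Here \<open>gain\<close> is replaced by its lower bound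
      \<open>1 / (2 * pi)\<close> and \<open>1 + 4 * (d N)\<^sup>2\<close> by 1.\<close>
    have "1 / (16 * \<rho> * real N ^ 3) = pi\<^sup>2 * (1 / (2 * pi))\<^sup>2 / (4 * \<rho> * real N ^ 3) * 1"
      by (simp add: power_mult_distrib power_divide)
    also have "\<dots> \<le> pi\<^sup>2 * (gain (d N))\<^sup>2 / (4 * \<rho> * real N ^ 3) * (1 + 4 * (d N)\<^sup>2)"
      using gain_bounds(3)[OF abs_d_le[of N]] \<rho> N
      by (intro mult_mono divide_right_mono mult_left_mono) (auto simp flip: abs_le_square_iff)
    also have "\<dots> = ?v N" by (simp add: var_f1_def d_def \<rho>_def)
    finally have "sqrt (1 / (16 * \<rho> * real N ^ 3)) \<le> sqrt (?v N)" by simp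
    moreover have "sqrt (1 / (16 * \<rho> * real N ^ 3)) = 1 / (4 * sqrt \<rho> * (real N * sqrt N))"
      by (simp add: real_sqrt_divide real_sqrt_mult power3_eq_cube)
    ultimately have le: "1 / (4 * sqrt \<rho> * (real N * sqrt N)) \<le> sqrt (?v N)" by simp
    moreover have pos: "0 < 1 / (4 * sqrt \<rho> * (real N * sqrt N))" using N \<rho> by simp
    ultimately have "inverse (sqrt (?v N)) \<le> inverse (1 / (4 * sqrt \<rho> * (real N * sqrt N)))"
      by (rule le_imp_inverse_le)
    moreover have "sqrt (?v N) > 0" using le pos by (rule less_le_trans[rotated])
    ultimately show "norm (inverse (sqrt (?v N))) \<le> 4 * sqrt \<rho> * norm (real N * sqrt N)"
      by (simp add: abs_of_pos del: real_sqrt_gt_0_iff)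
  qed
  moreover have "(\<lambda>N. ?f N - f1 - lin_err v N - ?\<mu> N) \<in> O(\<lambda>N. 1 / (real N)\<^sup>2)"
    by (rule sum_in_bigo(2)[OF f1_hat_linearised[OF a W2 Wp Wm] \<mu>_f1_bigo])
  ultimately have "(\<lambda>N. inverse (sqrt (?v N)) * (?f N - f1 - lin_err v N - ?\<mu> N))
      \<in> O(\<lambda>N. (real N * sqrt N) * (1 / (real N)\<^sup>2))"
    by (rule landau_o.big_mult)
  moreover have "(\<lambda>N. (real N * sqrt N) * (1 / (real N)\<^sup>2)) \<in> o(\<lambda>_. 1)" by real_asymp
  ultimately have "(\<lambda>N. inverse (sqrt (?v N)) * (?f N - f1 - lin_err v N - ?\<mu> N)) \<in> o(\<lambda>_. 1)"
    by (rule landau_o.big_small_trans)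
  then have "(\<lambda>N. inverse (sqrt (?v N)) * (?f N - f1 - lin_err v N - ?\<mu> N)) \<longlonglongrightarrow> 0"
    by (auto dest: smalloD_tendsto)
  moreover have "inverse (sqrt (?v N)) * (?f N - f1 - lin_err v N - ?\<mu> N)
      = (?f N - f1 - ?\<mu> N) / sqrt (?v N) - lin_err v N / sqrt (?v N)" for N
    by (simp add: divide_inverse algebra_simps)
  ultimately show ?thesis by simp
qed

text \<open>Choosing for every \<open>N\<close> a worst noise vector turns the statement about sequences into one that is
  uniform in the noise.\<close>

lemma f1_hat_standardised_uniform:
  fixes \<sigma> K e :: real
  assumes "\<sigma> > 0" "e > 0" "K \<ge> 0"
  defines "G \<equiv> \<lambda>N u b. norm b \<le> K \<and> norm (W (\<lambda>_. u) N (m2 N + \<nu>2 N)) \<le> K \<and>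
      norm (W (\<lambda>_. u) N (m1 N + \<nu>1 N + 1/2)) \<le> K * (1 / sqrt N) \<and>
      norm (W (\<lambda>_. u) N (m1 N + \<nu>1 N + - 1/2)) \<le> K * (1 / sqrt N)"
  defines "err \<equiv> \<lambda>N u b. (f1_hat N (x (\<lambda>_. u) N) b (m1 N) (m2 N) (\<nu>1 N) (\<nu>2 N) - f1
            - \<mu>_f1 N A1 (m1 N) (m2 N) (\<delta>1 N) (\<delta>2 N) (\<nu>1 N) (\<nu>2 N)) / sqrt (var_f1 N ((cmod A1)\<^sup>2 / \<sigma>\<^sup>2) (\<delta>1 N) (\<nu>1 N))
          - lin_err (\<lambda>_. u) N / sqrt (var_f1 N ((cmod A1)\<^sup>2 / \<sigma>\<^sup>2) (\<delta>1 N) (\<nu>1 N))"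
  shows "\<forall>\<^sub>F N in sequentially. \<forall>u b. G N u b \<longrightarrow> \<bar>err N u b\<bar> \<le> e"
proof -
  have "\<exists>u b. G N u b \<and> ((\<exists>u' b'. G N u' b' \<and> \<bar>err N u' b'\<bar> > e) \<longrightarrow> \<bar>err N u b\<bar> > e)" for N
  proof (cases "\<exists>u' b'. G N u' b' \<and> \<bar>err N u' b'\<bar> > e")
    case False
    \<comment> \<open>Without a violating pair, zero noise and zero amplitude serve as the default;
      they are admissible because \<open>K \<ge> 0\<close>.\<close>
    have "G N (\<lambda>_. 0) 0" using \<open>K \<ge> 0\<close> by (simp add: G_def W_def)
    then show ?thesis using False by blast
  qed blast
  then obtain v a where G: "\<And>N. G N (v N) (a N)"
    and worst: "\<And>N u b. G N u b \<Longrightarrow> \<bar>err N u b\<bar> > e \<Longrightarrow> \<bar>err N (v N) (a N)\<bar> > e" by metis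
  have W: "W (\<lambda>_. v N) N t = W v N t" and x: "x (\<lambda>_. v N) N = x v N"
    and lin: "lin_err (\<lambda>_. v N) N = lin_err v N" for N t
    by (simp_all add: W_def x_def lin_err_def fun_eq_iff)
  have "(\<lambda>N. err N (v N) (a N)) \<longlonglongrightarrow> 0"
    unfolding err_def x lin
  proof (rule f1_hat_standardised[OF \<open>\<sigma> > 0\<close>])
    show "(\<lambda>N. norm (a N)) \<in> O(\<lambda>_. 1)" "(\<lambda>N. norm (W v N (m2 N + \<nu>2 N))) \<in> O(\<lambda>_. 1)"
      "(\<lambda>N. norm (W v N (m1 N + \<nu>1 N + 1/2))) \<in> O(\<lambda>N. 1 / sqrt N)"
      "(\<lambda>N. norm (W v N (m1 N + \<nu>1 N + - 1/2))) \<in> O(\<lambda>N. 1 / sqrt N)"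
      using G unfolding G_def W by (intro norm_bigoI[where c = K]; simp)+
  qed
  from tendstoD[OF this \<open>e > 0\<close>] show ?thesis
    by eventually_elim (use worst in \<open>fastforce simp: not_less\<close>)
qed

text \<open>A real-linear functional of the noise has an exact normal law, so only its variance has
  to be identified. For \<open>N \<ge> 2\<close> the cross term of the two half-bin samples sums a
  cosine over a full period and vanishes.\<close>

lemma lin_err_normal:
  fixes \<sigma> :: real
  assumes "prob_space P" and w: "white_circular_gaussian P \<sigma> w" and "\<sigma> > 0" and N: "N \<ge> 2"
  shows "distr P borel (\<lambda>\<omega>. lin_err (\<lambda>_ n. w n \<omega>) N / sqrt (var_f1 N ((cmod A1)\<^sup>2 / \<sigma>\<^sup>2) (\<delta>1 N) (\<nu>1 N)))
    = std_normal_distribution"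
proof -
  interpret prob_space P by fact
  let ?v = "var_f1 N ((cmod A1)\<^sup>2 / \<sigma>\<^sup>2) (\<delta>1 N) (\<nu>1 N)"
  define g where "g = gain (d N)"
  define y where "y t n = - (2 * pi / N * t * n)" for t and n :: nat
  define tp where "tp = m1 N + \<nu>1 N + 1/2"
  define tm where "tm = m1 N + \<nu>1 N + - 1/2"
  define h where "h n = (d N - 1/2) * cis (y tp n) - (d N + 1/2) * cis (y tm n)" for n
  \<comment> \<open>The factor \<open>\<i>\<close> turns the negated imaginary part of
    \<open>lin_err\<close> into a real part. One \<open>1 / N\<close> stems from
    \<open>lin_err\<close>, the other from the average in \<open>W\<close>.\<close>
  define c where "c n = \<i> * of_real (pi * g / (real N)\<^sup>2) * (cis (- (pi * d N)) / A1) * h n" for n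
  have g: "g \<noteq> 0" using gain_bounds(1)[OF abs_d_le] by (simp add: g_def)
  have lin: "lin_err (\<lambda>_ n. w n \<omega>) N = Re (\<Sum>n<N. c n * w n \<omega>)" for \<omega>
  proof -
    define Wp where "Wp = (\<Sum>n<N. w n \<omega> * cis (y tp n))"
    define Wm where "Wm = (\<Sum>n<N. w n \<omega> * cis (y tm n))"
    define V where "V = (d N - 1/2) * Wp - (d N + 1/2) * Wm"
    have V: "V = (\<Sum>n<N. h n * w n \<omega>)"
      unfolding V_def Wp_def Wm_def sum_distrib_left sum_subtractf[symmetric]
      by (intro sum.cong refl) (simp only: h_def left_diff_distrib right_diff_distrib mult_ac)
    have W: "W (\<lambda>_ n. w n \<omega>) N tp = 1 / of_nat N * Wp" "W (\<lambda>_ n. w n \<omega>) N tm = 1 / of_nat N * Wm"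
      by (simp_all only: W_def Wp_def Wm_def y_def)
    have "(d N - 1/2) * (1 / of_nat N * Wp) - (d N + 1/2) * (1 / of_nat N * Wm) = 1 / of_nat N * V"
      by (simp only: V_def right_diff_distrib mult.left_commute)
    then have "lin_err (\<lambda>_ n. w n \<omega>) N = - (pi * g / N) * Im (1 / of_nat N * V * cis (- (pi * d N)) / A1)"
      unfolding lin_err_def tp_def[symmetric] tm_def[symmetric] W g_def by simp
    also have "\<dots> = Re (\<i> * of_real (pi * g / (real N)\<^sup>2) * (cis (- (pi * d N)) / A1) * V)"
    proof -
      have "\<i> * of_real (pi * g / (real N)\<^sup>2) * (cis (- (pi * d N)) / A1) * V
          = of_real (pi * g / N) * (\<i> * (1 / of_nat N * V * cis (- (pi * d N)) / A1))"
        by (simp add: power2_eq_square mult_ac)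
      then show ?thesis by (simp only: times_complex.sel Re_complex_of_real Im_complex_of_real Re_i_times) simp
    qed
    also have "\<dots> = Re (\<Sum>n<N. c n * w n \<omega>)"
      unfolding V c_def by (simp only: sum_distrib_left mult.assoc)
    finally show ?thesis .
  qed
  \<comment> \<open>Law of cosines for the two phasors, whose phases differ by one bin times
    \<open>n\<close>; the constant part is
    \<open>(d N - 1/2)\<^sup>2 + (d N + 1/2)\<^sup>2\<close>.\<close>
  have h2: "(cmod (h n))\<^sup>2 = (2 * (d N)\<^sup>2 + 1/2) - 2 * ((d N)\<^sup>2 - 1/4) * cos (2 * pi / N * 1 * n)" for n
  proof -
    have "y tm n - y tp n = 2 * pi / N * (tp - tm) * n"
      unfolding y_def by algebra
    then have "2 * pi / N * 1 * n = y tm n - y tp n" by (simp only: tp_def tm_def) simp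
    then have "cos (2 * pi / N * 1 * n) = cos (y tm n) * cos (y tp n) + sin (y tm n) * sin (y tp n)"
      by (simp only: cos_diff)
    moreover have "(cos (y tp n))\<^sup>2 = 1 - (sin (y tp n))\<^sup>2" "(cos (y tm n))\<^sup>2 = 1 - (sin (y tm n))\<^sup>2"
      by (simp_all add: cos_squared_eq)
    ultimately show ?thesis
      by (simp add: h_def cmod_power2 power2_diff power_mult_distrib) (simp add: power2_eq_square algebra_simps)
  qed
  have "(\<Sum>n<N. cos (2 * pi / N * 1 * real n)) = Re (of_nat N * mean_tone N 1)"
    using N by (simp add: mean_tone_def Re_sum)
  then have cos0: "(\<Sum>n<N. cos (2 * pi / N * 1 * real n)) = 0"
    using mean_tone_1_eq_0[OF N] by simp
  have sum_h: "(\<Sum>n<N. (cmod (h n))\<^sup>2) = N * (2 * (d N)\<^sup>2 + 1/2)"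
    unfolding h2 by (simp only: sum_subtractf sum_distrib_left[symmetric] cos0) simp
  have "(\<Sum>n<N. (cmod (c n))\<^sup>2) = (pi * g / (real N)\<^sup>2)\<^sup>2 / (cmod A1)\<^sup>2 * (\<Sum>n<N. (cmod (h n))\<^sup>2)"
    by (simp add: c_def norm_mult norm_divide norm_power power_mult_distrib power_divide sum_distrib_left)
  also have "\<dots> = 2 / \<sigma>\<^sup>2 * ?v"
    unfolding sum_h using N \<open>\<sigma> > 0\<close> A1
    by (simp add: var_f1_def g_def d_def power_mult_distrib power_divide eval_nat_numeral field_simps)
  finally have sum_c: "(\<Sum>n<N. (cmod (c n))\<^sup>2) = 2 / \<sigma>\<^sup>2 * ?v" .
  have v: "?v > 0" using N g \<open>\<sigma> > 0\<close> A1
    by (auto simp: var_f1_def g_def d_def intro!: mult_pos_pos divide_pos_pos add_pos_nonneg)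
  have sd: "\<sigma> / sqrt 2 * sqrt (2 / \<sigma>\<^sup>2 * ?v) = sqrt ?v"
    using \<open>\<sigma> > 0\<close> by (simp add: real_sqrt_mult real_sqrt_divide)
  have "distributed P lborel (\<lambda>\<omega>. lin_err (\<lambda>_ n. w n \<omega>) N) (normal_density 0 (sqrt ?v))"
    unfolding lin using white_gaussian_combination[OF w \<open>\<sigma> > 0\<close>, where c = c and N = N] v \<open>\<sigma> > 0\<close>
    unfolding sum_c sd by simp
  then have "distributed P lborel (\<lambda>\<omega>. lin_err (\<lambda>_ n. w n \<omega>) N / sqrt ?v) std_normal_density"
    using normal_standard_normal_convert[of "sqrt ?v" "\<lambda>\<omega>. lin_err (\<lambda>_ n. w n \<omega>) N" 0] v by simp
  then have "distr P lborel (\<lambda>\<omega>. lin_err (\<lambda>_ n. w n \<omega>) N / sqrt ?v) = std_normal_distribution"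
    by (rule distributed_distr_eq_density)
  moreover have "distr P lborel X = distr P borel X" for X :: "_ \<Rightarrow> real"
    by (intro distr_cong) auto
  ultimately show ?thesis by metis
qed

end

theorem lemma1:
  fixes P :: "'a measure" and w :: "nat \<Rightarrow> 'a \<Rightarrow> complex" and \<sigma> :: real
    and A1 A2 :: complex and f1 f2 :: real
    and m1 m2 :: "nat \<Rightarrow> int" and \<delta>1 \<delta>2 \<nu>1 \<nu>2 :: "nat \<Rightarrow> real"
    and A1_hat :: "nat \<Rightarrow> 'a \<Rightarrow> complex"
  assumes "prob_space P"
    and "\<sigma> > 0" and "white_circular_gaussian P \<sigma> w"
    and "A1 \<noteq> 0" and "A2 \<noteq> 0"
    and "f1 \<in> {-1/2..1/2}" and "f2 \<in> {-1/2..1/2}"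
    and "f1 \<noteq> f2" and "\<bar>f1 - f2\<bar> \<noteq> 1"
    and "\<And>N. N \<ge> 1 \<Longrightarrow> f1 = (m1 N + \<delta>1 N) / N" and "\<And>N. \<delta>1 N \<in> {-1/2..1/2}"
    and "\<And>N. N \<ge> 1 \<Longrightarrow> f2 = (m2 N + \<delta>2 N) / N" and "\<And>N. \<delta>2 N \<in> {-1/2..1/2}"
    and "\<And>N. \<nu>1 N \<in> {-1/2..1/2}" and "\<And>N. \<nu>2 N \<in> {-1/2..1/2}"
    and "\<And>N. A1_hat N \<in> borel_measurable P" and "bounded_in_probability P A1_hat"
  shows "asymp_normal P
           (\<lambda>N \<omega>. f1_hat N (two_tone A1 A2 f1 f2 w \<omega>) (A1_hat N \<omega>) (m1 N) (m2 N) (\<nu>1 N) (\<nu>2 N))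
           f1
           (\<lambda>N. \<mu>_f1 N A1 (m1 N) (m2 N) (\<delta>1 N) (\<delta>2 N) (\<nu>1 N) (\<nu>2 N))
           (\<lambda>N. var_f1 N ((cmod A1)\<^sup>2 / \<sigma>\<^sup>2) (\<delta>1 N) (\<nu>1 N))
         \<and> (\<forall>N\<ge>1. \<delta>1 N = \<nu>1 N \<and> \<delta>2 N = \<nu>2 N \<longrightarrow>
               \<mu>_f1 N A1 (m1 N) (m2 N) (\<delta>1 N) (\<delta>2 N) (\<nu>1 N) (\<nu>2 N) = 0)"
proof (intro conjI allI impI)
  fix N :: nat assume "\<delta>1 N = \<nu>1 N \<and> \<delta>2 N = \<nu>2 N"
  \<comment> \<open>With \<open>\<delta>2 = \<nu>2\<close> the Dirichlet factor is 1 and the two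
    leakage terms coincide.\<close>
  then have "\<beta> N (m1 N) (m2 N) (\<delta>2 N) (\<nu>1 N) (\<nu>2 N) s = 0" for s
    by (simp add: \<beta>_def dirichlet_factor_def)
  then show "\<mu>_f1 N A1 (m1 N) (m2 N) (\<delta>1 N) (\<delta>2 N) (\<nu>1 N) (\<nu>2 N) = 0"
    by (simp add: \<mu>_f1_def)
next
  interpret prob_space P by fact
  interpret two_tone_bins A1 A2 f1 f2 m1 m2 \<delta>1 \<delta>2 \<nu>1 \<nu>2
    using assms by unfold_locales
  note w = \<open>white_circular_gaussian P \<sigma> w\<close>
  note [measurable] = white_gaussian_measurable[OF w] \<open>\<And>N. A1_hat N \<in> borel_measurable P\<close> Ln_measurable
  define v where "v N = var_f1 N ((cmod A1)\<^sup>2 / \<sigma>\<^sup>2) (\<delta>1 N) (\<nu>1 N)" for N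
  define \<mu> where "\<mu> N = \<mu>_f1 N A1 (m1 N) (m2 N) (\<delta>1 N) (\<delta>2 N) (\<nu>1 N) (\<nu>2 N)" for N
  define X where "X N \<omega> = (f1_hat N (two_tone A1 A2 f1 f2 w \<omega>) (A1_hat N \<omega>) (m1 N) (m2 N) (\<nu>1 N) (\<nu>2 N)
      - f1 - \<mu> N) / sqrt (v N)" for N \<omega>
  define Y where "Y N \<omega> = lin_err (\<lambda>_ n. w n \<omega>) N / sqrt (v N)" for N \<omega>
  have [measurable]: "X N \<in> borel_measurable P" for N
    unfolding X_def f1_hat_def \<delta>1_hat_def z1_inv_def h1_hat_def S_hat_def A2_hat_def two_tone_def Let_def
    by measurable
  have [measurable]: "Y N \<in> borel_measurable P" for N
    unfolding Y_def lin_err_def W_def by measurable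
  have "weak_conv_m (\<lambda>N. distr P borel (X N)) std_normal_distribution"
  proof (rule weak_conv_m_converging_together[of X Y])
    \<comment> \<open>From \<open>N = 2\<close> on, the law of \<open>Y N\<close> is the limit law
      itself, so its weak convergence is that of an eventually constant sequence.\<close>
    have "\<forall>\<^sub>F N in sequentially. distr P borel (Y N) = std_normal_distribution"
      using eventually_ge_at_top[of 2]
    proof eventually_elim
      case (elim N)
      then show ?case unfolding Y_def v_def
        by (rule lin_err_normal[OF \<open>prob_space P\<close> w \<open>\<sigma> > 0\<close>])
    qed
    then show "weak_conv_m (\<lambda>N. distr P borel (Y N)) std_normal_distribution"
      unfolding weak_conv_m_def weak_conv_def
      by (auto intro!: tendsto_eventually elim: eventually_mono)
  next
    fix e :: real assume "e > 0"
    show "(\<lambda>N. prob {\<omega> \<in> space P. \<bar>X N \<omega> - Y N \<omega>\<bar> > e}) \<longlonglongrightarrow> 0"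
    proof (rule tendstoI)
      fix r :: real assume "r > 0"
      \<comment> \<open>Four exceptional events, one for the amplitude and three for noise samples,
        each receive \<open>r / 8\<close>, which leaves \<open>r / 2\<close> in total.\<close>
      obtain K1 where K1: "\<forall>\<^sub>F N in sequentially. prob {\<omega> \<in> space P. norm (A1_hat N \<omega>) > K1} \<le> r / 8"
        using \<open>bounded_in_probability P A1_hat\<close> \<open>r > 0\<close> unfolding bounded_in_probability_def
        by (meson divide_pos_pos zero_less_numeral)
      obtain K2 where K2: "\<And>N \<theta>. N \<ge> 1 \<Longrightarrow>
          prob {\<omega> \<in> space P. cmod (\<Sum>n<N. w n \<omega> * cis (\<theta> n)) > K2 * sqrt (real N)} \<le> r / 8"
        using white_gaussian_mean_tight[OF w \<open>\<sigma> > 0\<close>, of "r/8"] \<open>r > 0\<close> by auto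
      define K where "K = max 0 (max K1 K2)"
      define bad where "bad N t = {\<omega> \<in> space P. cmod (\<Sum>n<N. w n \<omega> * cis (- (2 * pi / N * t * n))) > K2 * sqrt (real N)}"
        for N :: nat and t
      define badA where "badA N = {\<omega> \<in> space P. norm (A1_hat N \<omega>) > K1}" for N
      have [measurable]: "bad N t \<in> sets P" "badA N \<in> sets P" for N t
        unfolding bad_def badA_def by measurable
      have W_le: "norm (W (\<lambda>_ n. w n \<omega>) N t) \<le> K * (1 / sqrt N)"
        if "\<omega> \<in> space P" "\<omega> \<notin> bad N t" "N \<ge> 1" for \<omega> N t
      proof -
        have "norm (W (\<lambda>_ n. w n \<omega>) N t) = 1 / N * cmod (\<Sum>n<N. w n \<omega> * cis (- (2 * pi / N * t * n)))"
          by (simp add: W_def norm_mult norm_divide)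
        also have "\<dots> \<le> 1 / N * (K * sqrt N)"
          using that by (intro mult_left_mono order_trans[OF _ mult_right_mono[of K2 K]])
            (auto simp: bad_def K_def not_less)
        also have "\<dots> = K * (1 / sqrt N)"
          using that by (simp add: field_simps)
        finally show ?thesis .
      qed
      have "K \<ge> 0" by (simp add: K_def)
      from f1_hat_standardised_uniform[OF \<open>\<sigma> > 0\<close> \<open>e > 0\<close> this] K1 eventually_ge_at_top[of 1]
      show "\<forall>\<^sub>F N in sequentially. dist (prob {\<omega> \<in> space P. \<bar>X N \<omega> - Y N \<omega>\<bar> > e}) 0 < r"
      proof eventually_elim
        case (elim N)
        let ?B = "badA N \<union> bad N (m2 N + \<nu>2 N) \<union> (bad N (m1 N + \<nu>1 N + 1/2) \<union> bad N (m1 N + \<nu>1 N + - 1/2))"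
        \<comment> \<open>Off the exceptional events the noise path and amplitude satisfy the
          conditions of the uniform deterministic bound.\<close>
        have "{\<omega> \<in> space P. \<bar>X N \<omega> - Y N \<omega>\<bar> > e} \<subseteq> ?B"
        proof (intro subsetI, rule ccontr)
          fix \<omega> assume "\<omega> \<in> {\<omega> \<in> space P. \<bar>X N \<omega> - Y N \<omega>\<bar> > e}" and good: "\<omega> \<notin> ?B"
          then have \<omega>: "\<omega> \<in> space P" and large: "\<bar>X N \<omega> - Y N \<omega>\<bar> > e" by auto
          \<comment> \<open>At the second tone's bin only the bound \<open>K\<close> is asked for,
            which the sharper \<open>K / sqrt N\<close> implies.\<close>
          have "1 / sqrt N \<le> 1" using elim(3) by simp
          then have "K * (1 / sqrt N) \<le> K" using \<open>K \<ge> 0\<close> by (intro mult_left_le)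
          moreover have "norm (A1_hat N \<omega>) \<le> K" using good \<omega> by (auto simp: badA_def K_def)
          moreover have "x (\<lambda>_ n. w n \<omega>) N = two_tone A1 A2 f1 f2 w \<omega>"
            by (simp add: fun_eq_iff x_def two_tone_def)
          ultimately have "\<bar>X N \<omega> - Y N \<omega>\<bar> \<le> e"
            using elim(1)[rule_format, of "A1_hat N \<omega>" "\<lambda>n. w n \<omega>"] good
              W_le[OF \<omega> _ elim(3), of "m2 N + \<nu>2 N"] W_le[OF \<omega> _ elim(3), of "m1 N + \<nu>1 N + 1/2"]
              W_le[OF \<omega> _ elim(3), of "m1 N + \<nu>1 N + - 1/2"]
            unfolding X_def Y_def v_def \<mu>_def Un_iff by force
          with large show False by simp
        qed
        then have "prob {\<omega> \<in> space P. \<bar>X N \<omega> - Y N \<omega>\<bar> > e} \<le> prob ?B"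
          by (intro finite_measure_mono) auto
        also have "\<dots> \<le> (prob (badA N) + prob (bad N (m2 N + \<nu>2 N)))
            + (prob (bad N (m1 N + \<nu>1 N + 1/2)) + prob (bad N (m1 N + \<nu>1 N + - 1/2)))"
          by (intro order_trans[OF measure_Un_le] add_mono measure_Un_le order_refl) measurable
        also have "\<dots> \<le> (r / 8 + r / 8) + (r / 8 + r / 8)"
          unfolding bad_def badA_def using elim(2,3) by (intro add_mono K2)
        finally show ?case using \<open>r > 0\<close> by simp
      qed
    qed
  qed (simp_all add: real_dist_normal_dist)
  then show "asymp_normal P
           (\<lambda>N \<omega>. f1_hat N (two_tone A1 A2 f1 f2 w \<omega>) (A1_hat N \<omega>) (m1 N) (m2 N) (\<nu>1 N) (\<nu>2 N))
           f1
           (\<lambda>N. \<mu>_f1 N A1 (m1 N) (m2 N) (\<delta>1 N) (\<delta>2 N) (\<nu>1 N) (\<nu>2 N))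
           (\<lambda>N. var_f1 N ((cmod A1)\<^sup>2 / \<sigma>\<^sup>2) (\<delta>1 N) (\<nu>1 N))"
    unfolding asymp_normal_def X_def \<mu>_def v_def .
qed

end
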